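(* Let $\mathbb{F}$ be an algebraically closed field of characteristic not two, let $n\ge3$, and let $X:V^{n-1}\to V$ be an $(n-1)$-fold cross product on the $n$-dimensional $\mathbb{F}$-vector space $V$, relative to a nondegenerate symmetric bilinear form $b$. Let $p,q\ge0$ with $p+2q=n$ and let $\Gamma(U,\delta_U)$ be the corresponding fine grading on $(V,X)$, where $U$ is the abelian group generated by $x_1,\dots,x_p,y_1,z_1,\dots,y_q,z_q$ subject to the relations $x_1^2=\cdots=x_p^2=y_1z_1=\cdots=y_qz_q=x_1\cdots x_py_1z_1\cdots y_qz_q$, and $\delta_U$ takes the value $1$ on these generators and $0$ elsewhere. Then the Weyl group is the Cartesian product of the symmetric group on $p$ symbols and the signed permutation group on $q$ symbols: $$W\big(\Gamma(U,\delta_U)\big)=\mathrm{Sym}_p\times\big((\mathbb{Z}/2)^q\rtimes\mathrm{Sym}_q\big).$$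
   Context: An $r$-fold cross product on $V$ relative to a nondegenerate symmetric bilinear form $b$ is a multilinear map $X:V^r\to V$ such that, for all $v_1,\dots,v_r\in V$, $b(X(v_1,\dots,v_r),v_i)=0$ for $1\le i\le r$, and $b(X(v_1,\dots,v_r),X(v_1,\dots,v_r))=\det\big(b(v_i,v_j)\big)$. $\mathrm{Aut}(V,X)$ is the group of linear automorphisms $\varphi$ of $V$ with $\varphi(X(v_1,\dots,v_r))=X(\varphi(v_1),\dots,\varphi(v_r))$. For an abelian group $G$, a $G$-grading on $(V,X)$ is a vector space decomposition $V=\bigoplus_{g\in G}V_g$ with $X(V_{g_1},\dots,V_{g_r})\subseteq V_{g_1\cdots g_r}$. For a map $\delta:G\to\mathbb{Z}_{\ge0}$ with $\sum_g\delta(g)=n$ and $\delta(g)=\delta(g^{-1}h)$ for all $g$, where $h=\prod_g g^{\delta(g)}$, $\Gamma(G,\delta)$ denotes the $G$-grading on $(V,X)$ with $\dim V_g=\delta(g)$ for all $g$ and $b(V_g,V_{g'})=0$ unless $gg'=h$; it exists and is unique up to an automorphism in $\mathrm{Aut}(V,X)$. The generators of $U$ above are pairwise distinct in $U$, and $\delta_U$ satisfies these conditions. The Weyl group $W(\Gamma)$ of a grading $\Gamma$ is the quotient of the group of elements of $\mathrm{Aut}(V,X)$ permuting the homogeneous components of $\Gamma$ by the subgroup of those that map each homogeneous component to itself. Here the factor $\mathrm{Sym}_p$ permutes the components of degrees $x_1,\dots,x_p$, and the signed permutation group permutes the pairs of components of degrees $\{y_j,z_j\}$, possibly swapping the members of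 each pair. *)

theory Defs
  imports
    "HOL-Algebra.Free_Abelian_Groups"
    "HOL-Algebra.Sym_Groups"
    "HOL-Computational_Algebra.Computational_Algebra"
    "Jordan_Normal_Form.Determinant"
begin

definition nondegenerate_symmetric_bilinear_form ::
    "('a::field \<Rightarrow> 'v::ab_group_add \<Rightarrow> 'v) \<Rightarrow> ('v \<Rightarrow> 'v \<Rightarrow> 'a) \<Rightarrow> bool"
  where "nondegenerate_symmetric_bilinear_form scale b \<longleftrightarrow>
    (\<forall>v. Vector_Spaces.linear scale (*) (b v)) \<and>
    (\<forall>w. Vector_Spaces.linear scale (*) (\<lambda>v. b v w)) \<and>
    (\<forall>v w. b v w = b w v) \<and>
    (\<forall>v. (\<forall>w. b v w = 0) \<longrightarrow> v = 0)"

text \<open>A map \<open>V\<^sup>r \<rightarrow> V\<close> is a function on lists; only its values on lists of length \<open>r\<close> matter.\<close>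

definition multilinear ::
    "('a::field \<Rightarrow> 'v::ab_group_add \<Rightarrow> 'v) \<Rightarrow> nat \<Rightarrow> ('v list \<Rightarrow> 'v) \<Rightarrow> bool"
  where "multilinear scale r X \<longleftrightarrow>
    (\<forall>vs i. length vs = r \<longrightarrow> i < r \<longrightarrow>
      Vector_Spaces.linear scale scale (\<lambda>v. X (vs[i := v])))"

definition cross_product ::
    "('a::field \<Rightarrow> 'v::ab_group_add \<Rightarrow> 'v) \<Rightarrow> nat \<Rightarrow> ('v \<Rightarrow> 'v \<Rightarrow> 'a) \<Rightarrow> ('v list \<Rightarrow> 'v) \<Rightarrow> bool"
  where "cross_product scale r b X \<longleftrightarrow>
    multilinear scale r X \<and>
    (\<forall>vs. length vs = r \<longrightarrow>
      (\<forall>i<r. b (X vs) (vs ! i) = 0) \<and>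
      b (X vs) (X vs) = Determinant.det (mat r r (\<lambda>(i, j). b (vs ! i) (vs ! j))))"

definition Aut ::
    "('a::field \<Rightarrow> 'v::ab_group_add \<Rightarrow> 'v) \<Rightarrow> nat \<Rightarrow> ('v list \<Rightarrow> 'v) \<Rightarrow> ('v \<Rightarrow> 'v) monoid"
  where "Aut scale r X = \<lparr>
    carrier = {\<phi>. Vector_Spaces.linear scale scale \<phi> \<and> bij \<phi> \<and>
                  (\<forall>vs. length vs = r \<longrightarrow> \<phi> (X vs) = X (map \<phi> vs))},
    monoid.mult = (\<circ>), one = id\<rparr>"

definition direct_sum_decomposition ::
    "('a::field \<Rightarrow> 'v::ab_group_add \<Rightarrow> 'v) \<Rightarrow> 'i set \<Rightarrow> ('i \<Rightarrow> 'v set) \<Rightarrow> bool"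
  where "direct_sum_decomposition scale I W \<longleftrightarrow>
    (\<forall>i\<in>I. module.subspace scale (W i)) \<and>
    (\<forall>v. \<exists>!f. (\<forall>i\<in>I. f i \<in> W i) \<and> (\<forall>i. i \<notin> I \<longrightarrow> f i = 0) \<and>
               finite {i. f i \<noteq> 0} \<and> v = (\<Sum>i | f i \<noteq> 0. f i))"

definition grading ::
    "('a::field \<Rightarrow> 'v::ab_group_add \<Rightarrow> 'v) \<Rightarrow> nat \<Rightarrow> ('v list \<Rightarrow> 'v) \<Rightarrow>
     ('g, 'm) monoid_scheme \<Rightarrow> ('g \<Rightarrow> 'v set) \<Rightarrow> bool"
  where "grading scale r X G \<Gamma> \<longleftrightarrow>
    direct_sum_decomposition scale (carrier G) \<Gamma> \<and>
    (\<forall>gs vs. length gs = r \<longrightarrow> set gs \<subseteq> carrier G \<longrightarrow>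
       list_all2 (\<lambda>v g. v \<in> \<Gamma> g) vs gs \<longrightarrow>
       X vs \<in> \<Gamma> (foldr (monoid.mult G) gs \<one>\<^bsub>G\<^esub>))"

text \<open>\<open>is_Gamma scale r b X G \<delta> \<Gamma>\<close> says that \<open>\<Gamma>\<close> is a grading of the kind denoted \<open>\<Gamma>(G, \<delta>)\<close>;
  these gradings are determined only up to an automorphism of \<open>(V, X)\<close>.\<close>

definition is_Gamma ::
    "('a::field \<Rightarrow> 'v::ab_group_add \<Rightarrow> 'v) \<Rightarrow> nat \<Rightarrow> ('v \<Rightarrow> 'v \<Rightarrow> 'a) \<Rightarrow> ('v list \<Rightarrow> 'v) \<Rightarrow>
     ('g, 'm) monoid_scheme \<Rightarrow>
     ('g \<Rightarrow> nat) \<Rightarrow> ('g \<Rightarrow> 'v set) \<Rightarrow> bool"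
  where "is_Gamma scale r b X G \<delta> \<Gamma> \<longleftrightarrow>
    grading scale r X G \<Gamma> \<and>
    (\<forall>g\<in>carrier G. vector_space.dim scale (\<Gamma> g) = \<delta> g) \<and>
    (\<forall>g\<in>carrier G. \<forall>g'\<in>carrier G.
       g \<otimes>\<^bsub>G\<^esub> g' \<noteq> gfinprod G (\<lambda>k. k [^]\<^bsub>G\<^esub> \<delta> k) (carrier G) \<longrightarrow>
       (\<forall>v\<in>\<Gamma> g. \<forall>w\<in>\<Gamma> g'. b v w = 0))"

definition components :: "('g, 'm) monoid_scheme \<Rightarrow> ('g \<Rightarrow> 'v::ab_group_add set) \<Rightarrow> 'v set set"
  where "components G \<Gamma> = {\<Gamma> g | g. g \<in> carrier G \<and> \<Gamma> g \<noteq> {0}}"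

definition Aut_grading ::
    "('a::field \<Rightarrow> 'v::ab_group_add \<Rightarrow> 'v) \<Rightarrow> nat \<Rightarrow> ('v list \<Rightarrow> 'v) \<Rightarrow>
     ('g, 'm) monoid_scheme \<Rightarrow> ('g \<Rightarrow> 'v set) \<Rightarrow> ('v \<Rightarrow> 'v) monoid"
  where "Aut_grading scale r X G \<Gamma> = (Aut scale r X)
    \<lparr>carrier := {\<phi> \<in> carrier (Aut scale r X). bij_betw ((`) \<phi>) (components G \<Gamma>) (components G \<Gamma>)}\<rparr>"

definition Stab_grading ::
    "('a::field \<Rightarrow> 'v::ab_group_add \<Rightarrow> 'v) \<Rightarrow> nat \<Rightarrow> ('v list \<Rightarrow> 'v) \<Rightarrow>
     ('g, 'm) monoid_scheme \<Rightarrow> ('g \<Rightarrow> 'v set) \<Rightarrow> ('v \<Rightarrow> 'v) set"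
  where "Stab_grading scale r X G \<Gamma> =
    {\<phi> \<in> carrier (Aut_grading scale r X G \<Gamma>). \<forall>W\<in>components G \<Gamma>. \<phi> ` W = W}"

definition Weyl_group ::
    "('a::field \<Rightarrow> 'v::ab_group_add \<Rightarrow> 'v) \<Rightarrow> nat \<Rightarrow> ('v list \<Rightarrow> 'v) \<Rightarrow>
     ('g, 'm) monoid_scheme \<Rightarrow> ('g \<Rightarrow> 'v set) \<Rightarrow> ('v \<Rightarrow> 'v) set monoid"
  where "Weyl_group scale r X G \<Gamma> = Aut_grading scale r X G \<Gamma> Mod Stab_grading scale r X G \<Gamma>"

definition presented_abelian_group :: "'s set \<Rightarrow> ('s \<Rightarrow>\<^sub>0 int) set \<Rightarrow> ('s \<Rightarrow>\<^sub>0 int) set monoid"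
  where "presented_abelian_group S R =
    free_Abelian_group S Mod generate (free_Abelian_group S) R"

definition presented_gen :: "'s set \<Rightarrow> ('s \<Rightarrow>\<^sub>0 int) set \<Rightarrow> 's \<Rightarrow> ('s \<Rightarrow>\<^sub>0 int) set"
  where "presented_gen S R s =
    generate (free_Abelian_group S) R #>\<^bsub>free_Abelian_group S\<^esub> frag_of s"

datatype U_symbol = XS nat | YS nat | ZS nat

definition U_symbols :: "nat \<Rightarrow> nat \<Rightarrow> U_symbol set"
  where "U_symbols p q = XS ` {1..p} \<union> YS ` {1..q} \<union> ZS ` {1..q}"

text \<open>The free abelian group is written additively, so a relation \<open>u = w\<close> is the relator \<open>u - w\<close>.\<close>

definition U_relators :: "nat \<Rightarrow> nat \<Rightarrow> (U_symbol \<Rightarrow>\<^sub>0 int) set"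
  where "U_relators p q =
    (let t = (\<Sum>s\<in>U_symbols p q. frag_of s) in
      {frag_of (XS i) + frag_of (XS i) - t | i. i \<in> {1..p}} \<union>
      {frag_of (YS j) + frag_of (ZS j) - t | j. j \<in> {1..q}})"

definition U_group :: "nat \<Rightarrow> nat \<Rightarrow> (U_symbol \<Rightarrow>\<^sub>0 int) set monoid"
  where "U_group p q = presented_abelian_group (U_symbols p q) (U_relators p q)"

definition U_gen :: "nat \<Rightarrow> nat \<Rightarrow> U_symbol \<Rightarrow> (U_symbol \<Rightarrow>\<^sub>0 int) set"
  where "U_gen p q = presented_gen (U_symbols p q) (U_relators p q)"

definition delta_U :: "nat \<Rightarrow> nat \<Rightarrow> (U_symbol \<Rightarrow>\<^sub>0 int) set \<Rightarrow> nat"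
  where "delta_U p q g = (if g \<in> U_gen p q ` U_symbols p q then 1 else 0)"

definition semidirect_product ::
    "('a, 'm) monoid_scheme \<Rightarrow> ('k, 'n) monoid_scheme \<Rightarrow> ('k \<Rightarrow> 'a \<Rightarrow> 'a) \<Rightarrow> ('a \<times> 'k) monoid"
  where "semidirect_product N K act = \<lparr>
    carrier = carrier N \<times> carrier K,
    monoid.mult = (\<lambda>(a, k) (a', k'). (a \<otimes>\<^bsub>N\<^esub> act k a', k \<otimes>\<^bsub>K\<^esub> k')),
    one = (\<one>\<^bsub>N\<^esub>, \<one>\<^bsub>K\<^esub>)\<rparr>"

text \<open>\<open>(\<epsilon>, \<tau>)\<close> acts on \<open>q\<close> pairs by sending the \<open>j\<close>-th pair to the \<open>\<tau> j\<close>-th one,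
  with a swap iff \<open>\<epsilon> (\<tau> j) = 1\<close>.\<close>

definition signed_permutation_group :: "nat \<Rightarrow> ((nat \<Rightarrow> int) \<times> (nat \<Rightarrow> nat)) monoid"
  where "signed_permutation_group q =
    semidirect_product (product_group {1..q} (\<lambda>_. integer_mod_group 2)) (sym_group q)
      (\<lambda>\<tau> \<epsilon>. \<lambda>j\<in>{1..q}. \<epsilon> (inv' \<tau> j))"

end

theory Submission
  imports Defs
begin

text \<open>
  Normalise a homogeneous basis so that \<open>b (e s) (e t)\<close> is \<open>1\<close> if \<open>t\<close> is the partner of \<open>s\<close>
  (\<open>x\<^sub>i\<close> with itself, \<open>y\<^sub>j\<close> with \<open>z\<^sub>j\<close>) and \<open>0\<close> otherwise. The product of all basis vectors but \<open>e t\<close> is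
  a nonzero multiple of the partner of \<open>e t\<close>, so an automorphism that permutes the homogeneous lines
  commutes with the partner map; the permutations that do so form the target group. Conversely, such
  a permutation gives an isometry \<open>P\<close> of \<open>b\<close>. Since \<open>b (X(v\<^sub>1,\<dots>,v\<^sub>n\<^sub>-\<^sub>1)) v\<^sub>n\<close> is alternating in \<open>n\<close>
  arguments, it is determined up to a scalar, so \<open>P\<close> preserves \<open>X\<close> up to a scalar, and a scalar multiple
  of \<open>P\<close>, by an \<open>(n-2)\<close>-th root, preserves \<open>X\<close>.
\<close>

text \<open>The axioms do not say that \<open>X\<close> is alternating; they give orthogonality of a
  product to its factors and its norm. Pairing a product with one further vector turns orthogonality
  into vanishing whenever some slot equals the last one, and skew-symmetry in the last slot spreads
  this to all pairs of slots. The norm axiom shows a product to be nonzero only when the Gram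
  determinant of its factors is nonzero. This fails for the basis vectors other than
  \<open>e t\<close> if \<open>t\<close> is not its own partner, and repairing it produces a
  diagonal Gram entry 2; here the characteristic matters. The exponent of the root has a simple
  origin: if \<open>P\<close> preserves \<open>X\<close> up to a factor \<epsilon>, then
  \<open>c P\<close> preserves it exactly when c^(n-1) \<epsilon> = c, that is c^(n-2) =
  1/\<epsilon> for nonzero c. The structure of \<open>U\<close> is never computed. That its
  generators are distinct is read off from the given grading by counting dimensions.\<close>

section \<open>Multilinear algebra: monomial determinants and alternating forms\<close>

lemma det_monomial_nonzero:
  fixes A :: "'a::idom mat"
  assumes A: "A \<in> carrier_mat n n" and \<sigma>: "\<sigma> permutes {0..<n}"
    and nz: "\<And>i j. i < n \<Longrightarrow> j < n \<Longrightarrow> A $$ (i, j) \<noteq> 0 \<longleftrightarrow> j = \<sigma> i"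
  shows "Determinant.det A \<noteq> 0"
proof -
  let ?t = "\<lambda>p. signof p * (\<Prod>i = 0..<n. A $$ (i, p i)) :: 'a"
  have other: "?t p = 0" if p: "p permutes {0..<n}" "p \<noteq> \<sigma>" for p
  proof -
    have "\<exists>i\<in>{0..<n}. p i \<noteq> \<sigma> i"
    proof (rule ccontr)
      assume "\<not> ?thesis"
      then have "p i = \<sigma> i" for i
        by (cases "i \<in> {0..<n}") (use p \<sigma> in \<open>auto simp: permutes_not_in\<close>)
      with p show False by auto
    qed
    then obtain i where i: "i \<in> {0..<n}" "p i \<noteq> \<sigma> i" by auto
    with p have "p i < n" by (metis atLeastLessThan_iff permutes_in_image)
    with i nz have "A $$ (i, p i) = 0" by auto
    with i(1) show ?thesis by (auto intro: prod_zero)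
  qed
  have "Determinant.det A = (\<Sum>p | p permutes {0..<n}. ?t p)"
    using A by (simp add: Determinant.det_def)
  also have "\<dots> = (\<Sum>p\<in>{\<sigma>}. ?t p)"
    by (rule sum.mono_neutral_right) (use \<sigma> other in \<open>auto simp: finite_permutations\<close>)
  also have "\<dots> \<noteq> 0"
  proof -
    have "A $$ (i, \<sigma> i) \<noteq> 0" if "i \<in> {0..<n}" for i
      using that nz \<sigma> by (metis atLeastLessThan_iff permutes_in_image)
    then show ?thesis by (simp add: sign_def)
  qed
  finally show ?thesis .
qed

context vector_space
begin

lemma multilinear_form_zero_if_zero_on_spanning_set:
  fixes D :: "(nat \<Rightarrow> 'b) \<Rightarrow> 'a"
  assumes lin: "\<And>f i. i < n \<Longrightarrow> Vector_Spaces.linear scale (*) (\<lambda>v. D (f(i := v)))"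
    and B: "span B = UNIV"
    and zero: "\<And>f. f ` {..<n} \<subseteq> B \<Longrightarrow> D f = 0"
  shows "D f = 0"
proof -
  \<comment> \<open>Slots below \<open>k\<close> hold arbitrary vectors and the others elements of
    \<open>B\<close>. Linearity in slot \<open>k\<close> frees one more slot at each stage.\<close>
  have "\<forall>f. f ` {k..<n} \<subseteq> B \<longrightarrow> D f = 0" if "k \<le> n" for k
    using that
  proof (induction k)
    case 0
    then show ?case using zero by (simp add: atLeast0LessThan)
  next
    case (Suc k)
    show ?case
    proof (intro allI impI)
      fix f assume f: "f ` {Suc k..<n} \<subseteq> B"
      interpret l: Vector_Spaces.linear scale "(*)" "\<lambda>v. D (f(k := v))"
        using Suc.prems by (intro lin) simp
      have "D (f(k := f k)) = 0"
      proof (rule l.eq_0_on_span)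
        show "f k \<in> span B" by (simp add: B)
        fix v assume "v \<in> B"
        moreover have "{k..<n} = insert k {Suc k..<n}" using Suc.prems by auto
        ultimately have "(f(k := v)) ` {k..<n} \<subseteq> B" using f by auto
        with Suc show "D (f(k := v)) = 0" by auto
      qed
      then show "D f = 0" by simp
    qed
  qed
  from this[of n] show ?thesis by simp
qed

text \<open>Polarisation: the mixed terms of \<open>?D (x + y) (x + y) = 0\<close> cancel. Vanishing
  is asked for at one pair of slots only, so the lemma applies before \<open>D\<close> is known to
  be alternating.\<close>

lemma skew_if_zero_on_equal:
  fixes D :: "(nat \<Rightarrow> 'b) \<Rightarrow> 'a"
  assumes lin: "\<And>f k. k \<in> {i, j} \<Longrightarrow> Vector_Spaces.linear scale (*) (\<lambda>v. D (f(k := v)))"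
    and alt: "\<And>f. f i = f j \<Longrightarrow> D f = 0" and ij: "i \<noteq> j"
  shows "D (f \<circ> Transposition.transpose i j) = - D f"
proof -
  let ?D = "\<lambda>x y. D (f(i := x, j := y))"
  have add_j: "?D x (y + z) = ?D x y + ?D x z" for x y z
    using lin[of j "f(i := x)"] by (simp add: Vector_Spaces.linear_def module_hom_iff)
  have add_i: "?D (x + y) z = ?D x z + ?D y z" for x y z
    using lin[of i "f(j := z)"] ij by (simp add: Vector_Spaces.linear_def module_hom_iff fun_upd_twist)
  have "?D x x = 0" for x by (rule alt) (use ij in auto)
  from this[of "f i + f j"] this[of "f i"] this[of "f j"]
  have "?D (f j) (f i) + ?D (f i) (f j) = 0" by (simp add: add_i add_j)
  moreover have "f \<circ> Transposition.transpose i j = f(i := f j, j := f i)"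
    using ij by (auto simp: Transposition.transpose_def)
  ultimately show ?thesis by (simp add: eq_neg_iff_add_eq_0)
qed

text \<open>Alternating forms in \<open>m + 1\<close> arguments on a space spanned by
  \<open>m + 1\<close> vectors are determined by one value. \<open>D\<close> takes a function on all
  of \<open>nat\<close>, so \<open>ext\<close> confines it to the slots up to \<open>m\<close>;
  \<open>alt\<close> compares slots with the last one only, as orthogonality of a cross product to
  its factors does.\<close>

lemma top_form_zero:
  fixes D :: "(nat \<Rightarrow> 'b) \<Rightarrow> 'a"
  assumes lin: "\<And>f i. i \<le> m \<Longrightarrow> Vector_Spaces.linear scale (*) (\<lambda>v. D (f(i := v)))"
    and alt: "\<And>f i. i < m \<Longrightarrow> f i = f m \<Longrightarrow> D f = 0"
    and ext: "\<And>f g. (\<And>i. i \<le> m \<Longrightarrow> f i = g i) \<Longrightarrow> D f = D g"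
    and span: "span (e ` {..m}) = UNIV"
    and e: "inj_on e {..m}" "D e = 0"
  shows "D f = 0"
proof -
  have skew_m: "D (f \<circ> Transposition.transpose i m) = - D f" if "i < m" for f i
    using that by (intro skew_if_zero_on_equal lin alt[of i]) auto
  \<comment> \<open>Exchanging slots \<open>j\<close> and \<open>m\<close> costs a sign and turns a
    coincidence of \<open>i\<close> with \<open>j\<close> into one of \<open>i\<close> with
    \<open>m\<close>.\<close>
  have alt2: "D f = 0" if "i < j" "j \<le> m" "f i = f j" for f i j
  proof (cases "j = m")
    case False
    with that have "D (f \<circ> Transposition.transpose j m) = 0"
      by (intro alt[of i]) (auto simp: Transposition.transpose_def)
    with skew_m[of j f] that False show ?thesis by simp
  qed (use that alt[of i] in simp)
  have alt3: "D f = 0" if "i \<le> m" "j \<le> m" "i \<noteq> j" "f i = f j" for f i j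
    using that alt2[of i j f] alt2[of j i f] by (cases "i < j") auto
  have skew: "D (f \<circ> Transposition.transpose i j) = - D f" if "i \<le> m" "j \<le> m" "i \<noteq> j" for f i j
    using that by (intro skew_if_zero_on_equal lin alt3[of i j]) auto
  have perm: "D (e \<circ> p) = 0" if "p permutes {..m}" for p
    using finite_atMost[of m] that
  proof (induction rule: permutes_rev_induct)
    case (swap a b p)
    then show ?case using skew[of a b "e \<circ> p"] by (simp add: comp_def)
  qed (use e in simp)
  show ?thesis
  proof (rule multilinear_form_zero_if_zero_on_spanning_set[of "Suc m"])
    show "span (e ` {..m}) = UNIV" by (rule span)
    fix f :: "nat \<Rightarrow> 'b" assume f: "f ` {..<Suc m} \<subseteq> e ` {..m}"
    show "D f = 0"
    proof (cases "inj_on f {..m}")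
      case False
      then show ?thesis using alt3 by (auto simp: inj_on_def)
    next
      case True
      \<comment> \<open>\<open>f\<close> lists the vectors of \<open>e\<close> in another order.
        Above \<open>m\<close> the identity is chosen, as \<open>permutes\<close> demands;
        \<open>ext\<close> makes those slots harmless.\<close>
      define p where "p i = (if i \<le> m then inv_into {..m} e (f i) else i)" for i
      have f': "f i \<in> e ` {..m}" if "i \<le> m" for i using f that by auto
      have "p permutes {..m}"
      proof (rule bij_imp_permutes)
        have "inj_on p {..m}"
          using True f' by (auto simp: inj_on_def p_def inv_into_injective)
        moreover have "p ` {..m} \<subseteq> {..m}"
        proof
          fix k assume "k \<in> p ` {..m}"
          then show "k \<in> {..m}" using f' inv_into_into[of _ e "{..m}"] by (force simp: p_def)
        qed
        ultimately show "bij_betw p {..m} {..m}"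
          by (metis bij_betw_def endo_inj_surj finite_atMost)
      qed (simp add: p_def)
      moreover have "D f = D (e \<circ> p)"
        by (rule ext) (simp add: p_def f_inv_into_f f')
      ultimately show ?thesis using perm by simp
    qed
  qed (simp add: lin less_Suc_eq_le del: fun_upd_apply)
qed

end

section \<open>Cross products evaluated on a basis that is dual to itself up to the partner
  map\<close>

text \<open>Abstract indices with an involution stand for the generators of \<open>U\<close>, which
  keeps the grading group out of the linear algebra. By \<open>b_e\<close>, the vectors
  \<open>e (prt s)\<close> are the dual basis of the vectors \<open>e s\<close>.\<close>

locale cross_product_basis = vector_space scale
  for scale :: "'a::field \<Rightarrow> 'v::ab_group_add \<Rightarrow> 'v" +
  fixes b :: "'v \<Rightarrow> 'v \<Rightarrow> 'a" and X :: "'v list \<Rightarrow> 'v" and m :: nat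
    and S :: "'s set" and e :: "'s \<Rightarrow> 'v" and prt :: "'s \<Rightarrow> 's"
  assumes two: "(2::'a) \<noteq> 0"
    and form: "nondegenerate_symmetric_bilinear_form scale b"
    and cross: "cross_product scale m b X"
    and fin: "finite S" and card_S: "card S = Suc m"
    and prt_in: "s \<in> S \<Longrightarrow> prt s \<in> S" and prt_prt: "s \<in> S \<Longrightarrow> prt (prt s) = s"
    and span_e: "span (e ` S) = UNIV"
    and b_e: "s \<in> S \<Longrightarrow> t \<in> S \<Longrightarrow> b (e s) (e t) = (if t = prt s then 1 else 0)"
begin

lemma prt_eq_iff: "s \<in> S \<Longrightarrow> t \<in> S \<Longrightarrow> prt s = prt t \<longleftrightarrow> s = t"
  using prt_prt by metis

lemma prt_eq_swap: "s \<in> S \<Longrightarrow> t \<in> S \<Longrightarrow> s = prt t \<longleftrightarrow> t = prt s"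
  using prt_prt by metis

lemma linear_b_right: "Vector_Spaces.linear scale (*) (b v)"
  and linear_b_left: "Vector_Spaces.linear scale (*) (\<lambda>v. b v w)"
  and b_commute: "b v w = b w v"
  and b_nondegenerate: "(\<And>w. b v w = 0) \<Longrightarrow> v = 0"
  using form by (auto simp: nondegenerate_symmetric_bilinear_form_def)

lemma b_add_left: "b (v + v') w = b v w + b v' w" and b_scale_left: "b (scale c v) w = c * b v w"
  using linear_b_left[of w] by (auto simp: Vector_Spaces.linear_def module_hom_iff)

lemma b_add_right: "b w (v + v') = b w v + b w v'" and b_scale_right: "b w (scale c v) = c * b w v"
  using linear_b_right[of w] by (auto simp: Vector_Spaces.linear_def module_hom_iff)

lemma b_diff_left: "b (v - v') w = b v w - b v' w"
  using b_add_left[of "v - v'" v' w] by simp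

lemma eq_zero_if_orthogonal:
  assumes "\<And>s. s \<in> S \<Longrightarrow> b v (e s) = 0"
  shows "v = 0"
proof (rule b_nondegenerate)
  fix w
  interpret Vector_Spaces.linear scale "(*)" "b v" by (rule linear_b_right)
  have "w \<in> span (e ` S)" by (simp add: span_e)
  then show "b v w = 0" by (rule eq_0_on_span[rotated]) (use assms in auto)
qed

text \<open>The vectors orthogonal to all members of a basis but one form the line of the
  corresponding dual basis vector, here \<open>e (prt t)\<close>.\<close>

lemma eq_scale_if_orthogonal:
  assumes t: "t \<in> S" and orth: "\<And>s. s \<in> S \<Longrightarrow> s \<noteq> t \<Longrightarrow> b v (e s) = 0"
  shows "v = scale (b v (e t)) (e (prt t))"
proof -
  have "v - scale (b v (e t)) (e (prt t)) = 0"
    by (rule eq_zero_if_orthogonal)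
      (use t orth in \<open>auto simp: b_diff_left b_scale_left b_e prt_in prt_prt\<close>)
  then show ?thesis by simp
qed

text \<open>With arguments given by a function, changing one of them is a function update, and slot
  \<open>m\<close>, which \<open>X_fun\<close> ignores, is free for the extra argument of
  \<open>top_form\<close>.\<close>

definition X_fun :: "(nat \<Rightarrow> 'v) \<Rightarrow> 'v"
  where "X_fun f = X (map f [0..<m])"

lemma X_fun_linear:
  assumes "i < m"
  shows "Vector_Spaces.linear scale scale (\<lambda>v. X_fun (f(i := v)))"
proof -
  have "map (f(i := v)) [0..<m] = (map f [0..<m])[i := v]" for v
    using assms by (intro nth_equalityI) (auto simp: nth_list_update)
  then show ?thesis
    using cross assms by (simp add: X_fun_def cross_product_def multilinear_def)
qed

lemma X_fun_orthogonal: "i < m \<Longrightarrow> b (X_fun f) (f i) = 0"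
  using cross by (auto simp: X_fun_def cross_product_def dest!: spec[of _ "map f [0..<m]"])

lemma X_fun_norm: "b (X_fun f) (X_fun f) = Determinant.det (mat m m (\<lambda>(i, j). b (f i) (f j)))"
proof -
  have "mat m m (\<lambda>(i, j). b (map f [0..<m] ! i) (map f [0..<m] ! j)) = mat m m (\<lambda>(i, j). b (f i) (f j))"
    by (intro eq_matI) auto
  with cross show ?thesis by (simp add: X_fun_def cross_product_def)
qed

text \<open>The hypotheses make the Gram matrix of the factors monomial, with its nonzero entries at
  the places of the permutation \<sigma>.\<close>

lemma X_fun_norm_nonzero:
  assumes "\<And>i. i < m \<Longrightarrow> \<sigma> i < m" "inj_on \<sigma> {..<m}"
    and nz: "\<And>i j. i < m \<Longrightarrow> j < m \<Longrightarrow> b (f i) (f j) \<noteq> 0 \<longleftrightarrow> j = \<sigma> i"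
  shows "b (X_fun f) (X_fun f) \<noteq> 0"
proof -
  let ?\<sigma> = "\<lambda>i. if i < m then \<sigma> i else i"
  have "bij_betw \<sigma> {0..<m} {0..<m}"
    using assms(1,2) endo_inj_surj[of "{0..<m}" \<sigma>] by (auto simp: bij_betw_def atLeast0LessThan)
  then have "bij_betw ?\<sigma> {0..<m} {0..<m}" using bij_betw_cong[of "{0..<m}" ?\<sigma> \<sigma>] by simp
  then have "?\<sigma> permutes {0..<m}" by (rule bij_imp_permutes) auto
  then show ?thesis
    unfolding X_fun_norm by (rule det_monomial_nonzero[rotated]) (use nz in auto)
qed

text \<open>A volume form: the output of \<open>X\<close>, converted by \<open>b\<close> into one
  more argument. Nondegeneracy of \<open>b\<close> lets \<open>X\<close> be recovered from
  it.\<close>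

definition top_form :: "(nat \<Rightarrow> 'v) \<Rightarrow> 'a"
  where "top_form f = b (X_fun f) (f m)"

text \<open>The product is orthogonal to each of its factors, hence to every basis vector except
  \<open>e (g m)\<close>.\<close>

lemma X_fun_homogeneous:
  assumes g: "bij_betw g {..m} S"
  shows "X_fun (e \<circ> g) = scale (top_form (e \<circ> g)) (e (prt (g m)))"
proof -
  have "b (X_fun (e \<circ> g)) (e s) = 0" if s: "s \<in> S" "s \<noteq> g m" for s
  proof -
    from g s obtain i where "i \<le> m" "s = g i" by (auto simp: bij_betw_def)
    with s X_fun_orthogonal[of i "e \<circ> g"] show ?thesis by (cases "i = m") auto
  qed
  then show ?thesis
    using g eq_scale_if_orthogonal[of "g m"] by (simp add: top_form_def bij_betw_apply)
qed

text \<open>The product of all basis vectors but \<open>e t\<close> is isotropic when \<open>prt t \<noteq> t\<close>. Its nonvanishing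
  then comes from replacing \<open>e (prt t)\<close> by the anisotropic vector \<open>e t + e (prt t)\<close>.\<close>

lemma top_form_nonzero:
  assumes g: "bij_betw g {..m} S"
  shows "top_form (e \<circ> g) \<noteq> 0"
proof
  assume top: "top_form (e \<circ> g) = 0"
  let ?t = "g m"
  have gS: "g i \<in> S" if "i \<le> m" for i using g that by (auto simp: bij_betw_def)
  have g_eq: "g i = g j \<longleftrightarrow> i = j" if "i \<le> m" "j \<le> m" for i j
    using g that by (auto simp: bij_betw_def inj_on_def)
  define k where "k s = inv_into {..m} g s" for s
  have k: "k s \<le> m" "g (k s) = s" if "s \<in> S" for s
    using g that inv_into_into[of s g "{..m}"] by (auto simp: k_def bij_betw_def f_inv_into_f)
  have k_eq: "k s = i \<longleftrightarrow> s = g i" if "s \<in> S" "i \<le> m" for s i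
    using k[OF that(1)] g_eq[of "k s" i] that(2) by metis
  have t: "?t \<in> S" using gS by simp
  have 0: "X_fun (e \<circ> g) = 0" using X_fun_homogeneous[OF g] unfolding top by simp
  show False
  proof (cases "prt ?t = ?t")
    case True
    \<comment> \<open>The permutation sends the position of an index to the position of its partner.
      It preserves the positions below \<open>m\<close> because the index at \<open>m\<close> is its
      own partner.\<close>
    have "b (X_fun (e \<circ> g)) (X_fun (e \<circ> g)) \<noteq> 0"
    proof (rule X_fun_norm_nonzero[where \<sigma> = "\<lambda>i. k (prt (g i))"])
      fix i assume i: "i < m"
      then have s: "prt (g i) \<in> S" using gS prt_in by simp
      have "prt (g i) \<noteq> g m" using i True gS[of i] t g_eq[of i m] prt_prt[of "g i"] by auto
      with k_eq[OF s, of m] k[OF s] show "k (prt (g i)) < m" by auto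
      fix j assume j: "j < m"
      then show "b ((e \<circ> g) i) ((e \<circ> g) j) \<noteq> 0 \<longleftrightarrow> j = k (prt (g i))"
        using k_eq[OF s, of j] i gS by (auto simp: b_e)
    next
      show "inj_on (\<lambda>i. k (prt (g i))) {..<m}"
        using gS prt_in by (auto simp: inj_on_def k_eq k prt_eq_iff g_eq)
    qed
    then show False using 0 b_scale_left[of 0 0 0] by simp
  next
    case False
    define r where "r = k (prt ?t)"
    have r: "r < m" "g r = prt ?t"
      using k[OF prt_in[OF t]] k_eq[OF prt_in[OF t], of m] False by (auto simp: r_def)
    let ?f = "\<lambda>v. (e \<circ> g)(r := v)"
    let ?y = "X_fun (?f (e ?t))" and ?x = "X_fun (?f (e ?t + e (prt ?t)))"
    \<comment> \<open>With \<open>e (prt ?t)\<close> in slot \<open>r\<close> the product is the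
      original one, assumed to vanish, so this summand does not change the value.\<close>
    have "?x = ?y + X_fun (?f (e (prt ?t)))"
      using X_fun_linear[OF r(1), of "e \<circ> g"] by (simp add: Vector_Spaces.linear_def module_hom_iff)
    moreover have "?f (e (prt ?t)) = e \<circ> g" using r by auto
    ultimately have x: "?x = ?y" using 0 by simp
    \<comment> \<open>Orthogonality to all other factors puts \<open>?y\<close> on the line of
      \<open>e ?t\<close>. As \<open>e ?t\<close> is itself a factor of \<open>?y\<close>, it
      follows that \<open>?y\<close> is isotropic.\<close>
    have "?y = scale (b ?y (e (prt ?t))) (e (prt (prt ?t)))"
    proof (rule eq_scale_if_orthogonal)
      show "prt ?t \<in> S" using t prt_in by simp
      fix s assume s: "s \<in> S" "s \<noteq> prt ?t"
      show "b ?y (e s) = 0"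
      proof (cases "s = ?t")
        case True
        then show ?thesis using X_fun_orthogonal[OF r(1), of "?f (e ?t)"] by simp
      next
        case False
        then have "k s < m" "k s \<noteq> r"
          using s k[of s] k_eq[of s m] k_eq[of s r] r by auto
        then show ?thesis using X_fun_orthogonal[of "k s" "?f (e ?t)"] s k by simp
      qed
    qed
    then have y: "?y = scale (b ?y (e (prt ?t))) (e ?t)" using t prt_prt by simp
    have "b ?y (e ?t) = 0" using X_fun_orthogonal[OF r(1), of "?f (e ?t)"] by simp
    then have "b ?y ?y = 0" by (subst (2) y) (simp add: b_scale_right)
    \<comment> \<open>The vector in slot \<open>r\<close> pairs to 2 with itself. It pairs to 0 with
      every other factor, since neither \<open>?t\<close> nor \<open>prt ?t\<close> labels another
      slot. So slot \<open>r\<close> is fixed and the others are matched by partners.\<close>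
    moreover have "b ?x ?x \<noteq> 0"
    proof (rule X_fun_norm_nonzero[where \<sigma> = "\<lambda>i. if i = r then r else k (prt (g i))"])
      have *: "k (prt (g i)) < m \<and> k (prt (g i)) \<noteq> r" if i: "i < m" "i \<noteq> r" for i
      proof -
        have s: "prt (g i) \<in> S" using gS prt_in i by simp
        have "prt (g i) \<noteq> g m" using i r gS[of i] t g_eq[of i r] prt_prt[of "g i"] by auto
        moreover have "prt (g i) \<noteq> g r" using i r gS[of i] t g_eq[of i m] prt_eq_iff[of "g i" "g m"] by auto
        ultimately show ?thesis using k_eq[OF s] k[OF s] r(1) by (auto simp: less_le)
      qed
      then show "(if i = r then r else k (prt (g i))) < m" if "i < m" for i
        using that by simp
      show "inj_on (\<lambda>i. if i = r then r else k (prt (g i))) {..<m}"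
        using * gS prt_in by (auto simp: inj_on_def k_eq k prt_eq_iff g_eq)
      fix i j assume ij: "i < m" "j < m"
      show "b (?f (e ?t + e (prt ?t)) i) (?f (e ?t + e (prt ?t)) j) \<noteq> 0
        \<longleftrightarrow> j = (if i = r then r else k (prt (g i)))"
      proof -
        have s: "prt (g i) \<in> S" using gS prt_in ij by simp
        have gr: "g i = prt ?t \<longleftrightarrow> i = r" "g j = prt ?t \<longleftrightarrow> j = r" "g i \<noteq> ?t" "g j \<noteq> ?t"
          unfolding r(2)[symmetric] using ij r(1) by (simp_all add: g_eq)
        have gp: "?t = prt (g i) \<longleftrightarrow> i = r"
          using prt_eq_swap[of ?t "g i"] gr(1) gS[of i] t ij(1) by simp
        have eS: "g i \<in> S" "g j \<in> S" using gS ij by auto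
        have tt: "b (e ?t) (e ?t) = 0" "b (e (prt ?t)) (e (prt ?t)) = 0"
          "b (e ?t) (e (prt ?t)) = 1" "b (e (prt ?t)) (e ?t) = 1"
          using False t prt_in[OF t] by (auto simp: b_e prt_prt)
        show ?thesis
        proof (cases "i = r")
          case True
          then show ?thesis
            using gr eS(2) t prt_in[OF t] two
            by (cases "j = r") (simp_all add: b_add_left b_add_right tt b_e prt_prt)
        next
          case i: False
          have k: "k (prt (g i)) = j \<longleftrightarrow> g j = prt (g i)" using k_eq[OF s, of j] ij(2) by auto
          have "prt ?t \<noteq> prt (g i)" using gr(3) prt_eq_iff[OF t eS(1)] by simp
          then show ?thesis
            using gp i * [OF ij(1) i] k eS t prt_in[OF t]
            by (cases "j = r") (auto simp: b_add_right b_e)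
        qed
      qed
    qed
    ultimately show False using x by simp
  qed
qed

end

section \<open>Automorphisms and permutations of the basis lines\<close>

context cross_product_basis
begin

lemma e_nonzero: "s \<in> S \<Longrightarrow> e s \<noteq> 0"
proof
  assume s: "s \<in> S" "e s = 0"
  with b_e[OF s(1) prt_in[OF s(1)]] b_scale_left[of 0 0 "e (prt s)"] show False by simp
qed

lemma X_fun_cong: "(\<And>i. i < m \<Longrightarrow> f i = g i) \<Longrightarrow> X_fun f = X_fun g"
  unfolding X_fun_def by (intro arg_cong[of _ _ X] map_cong) auto

lemma X_fun_scale: "X_fun (\<lambda>i. scale c (f i)) = scale (c ^ m) (X_fun f)"
proof -
  have "X_fun (\<lambda>i. if i < k then scale c (f i) else f i) = scale (c ^ k) (X_fun f)"
    if "k \<le> m" for k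
    using that
  proof (induction k)
    case (Suc k)
    let ?f = "\<lambda>i. if i < k then scale c (f i) else f i"
    have "X_fun (\<lambda>i. if i < Suc k then scale c (f i) else f i) = X_fun (?f(k := scale c (f k)))"
      by (intro X_fun_cong) auto
    also have "\<dots> = scale c (X_fun (?f(k := f k)))"
      using X_fun_linear[of k ?f] Suc.prems by (simp add: Vector_Spaces.linear_def module_hom_iff)
    also have "?f(k := f k) = ?f" by auto
    finally show ?case using Suc by simp
  qed simp
  from this[of m] have "X_fun (\<lambda>i. if i < m then scale c (f i) else f i) = scale (c ^ m) (X_fun f)"
    by simp
  moreover have "X_fun (\<lambda>i. if i < m then scale c (f i) else f i) = X_fun (\<lambda>i. scale c (f i))"
    by (rule X_fun_cong) simp
  ultimately show ?thesis by simp
qed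

lemma Aut_X_fun: "\<phi> \<in> carrier (Aut scale m X) \<Longrightarrow> \<phi> (X_fun f) = X_fun (\<phi> \<circ> f)"
  by (simp add: Aut_def X_fun_def)

lemma enumeration_ending_at:
  assumes "t \<in> S"
  obtains g where "bij_betw g {..m} S" "g m = t"
proof -
  obtain h where h: "bij_betw h {..m} S"
    using ex_bij_betw_nat_finite[OF fin] card_S by (auto simp: atLeast0LessThan lessThan_Suc_atMost)
  with assms obtain k where k: "k \<le> m" "h k = t" by (auto simp: bij_betw_def)
  have "bij_betw (Transposition.transpose k m) {..m} {..m}"
    using k by (intro permutes_imp_bij permutes_swap_id) auto
  with h have "bij_betw (h \<circ> Transposition.transpose k m) {..m} S" by (rule bij_betw_trans[rotated])
  moreover have "(h \<circ> Transposition.transpose k m) m = t" using k by simp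
  ultimately show ?thesis using that by blast
qed

lemma Aut_permutation_commutes_prt:
  assumes \<phi>: "\<phi> \<in> carrier (Aut scale m X)" and \<pi>: "bij_betw \<pi> S S"
    and line: "\<And>s. s \<in> S \<Longrightarrow> \<phi> (e s) = scale (a s) (e (\<pi> s))" and t: "t \<in> S"
  shows "\<pi> (prt t) = prt (\<pi> t)"
proof -
  have lin: "Vector_Spaces.linear scale scale \<phi>" and bij: "bij \<phi>"
    using \<phi> by (auto simp: Aut_def)
  interpret l: Vector_Spaces.linear scale scale \<phi> by (rule lin)
  have \<phi>0: "\<phi> v \<noteq> 0" if "v \<noteq> 0" for v
    using that bij l.zero by (metis bij_pointE)
  have a: "a s \<noteq> 0" if "s \<in> S" for s
    using \<phi>0[OF e_nonzero[OF that]] line[OF that] by auto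
  have \<pi>S: "\<pi> s \<in> S" if "s \<in> S" for s using \<pi> that by (auto simp: bij_betw_def)
  obtain g where g: "bij_betw g {..m} S" "g m = t" using enumeration_ending_at[OF t] .
  define c where "c = top_form (e \<circ> g)"
  have c: "c \<noteq> 0" unfolding c_def by (rule top_form_nonzero[OF g(1)])
  define x where "x = \<phi> (X_fun (e \<circ> g))"
  have "x = scale (c * a (prt t)) (e (\<pi> (prt t)))"
    unfolding x_def X_fun_homogeneous[OF g(1)] c_def[symmetric]
    by (simp add: l.scale line g prt_in t)
  \<comment> \<open>An automorphism carries the product to the product of the images, so
    \<open>x\<close> is orthogonal to the images of all basis vectors but
    \<open>e t\<close>.\<close>
  moreover have "x = scale (b x (e (\<pi> t))) (e (prt (\<pi> t)))"
  proof (rule eq_scale_if_orthogonal)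
    fix s assume s: "s \<in> S" "s \<noteq> \<pi> t"
    then obtain u where u: "u \<in> S" "s = \<pi> u" using \<pi> by (auto simp: bij_betw_def)
    with g(1) obtain i where i: "i \<le> m" "u = g i" by (auto simp: bij_betw_def)
    with s u g have "i < m" by (cases "i = m") auto
    then have "b x ((\<phi> \<circ> (e \<circ> g)) i) = 0"
      unfolding x_def Aut_X_fun[OF \<phi>] by (rule X_fun_orthogonal)
    with u i line[OF u(1)] a[OF u(1)] show "b x (e s) = 0" by (simp add: b_scale_right)
  qed (use t \<pi>S in simp)
  ultimately have eq: "scale (c * a (prt t)) (e (\<pi> (prt t))) = scale (b x (e (\<pi> t))) (e (prt (\<pi> t)))"
    by simp
  \<comment> \<open>The dual partner of \<open>e (\<pi> (prt t))\<close>: pairing both expressions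
    for \<open>x\<close> with it shows that they lie on the same basis line.\<close>
  let ?w = "e (prt (\<pi> (prt t)))"
  have S: "\<pi> (prt t) \<in> S" "prt (\<pi> (prt t)) \<in> S" "\<pi> t \<in> S" "prt (\<pi> t) \<in> S"
    using t \<pi>S prt_in by auto
  have "b (scale (c * a (prt t)) (e (\<pi> (prt t)))) ?w \<noteq> 0"
    using S c a[OF prt_in[OF t]] by (simp add: b_scale_left b_e)
  then have "b (e (prt (\<pi> t))) ?w \<noteq> 0"
    unfolding eq by (simp add: b_scale_left)
  then have "prt (\<pi> (prt t)) = \<pi> t"
    using S by (auto simp: b_e prt_prt prt_eq_iff split: if_splits)
  then show ?thesis using prt_prt[OF S(1)] by simp
qed

lemma b_sum_right: "b v (\<Sum>s\<in>A. f s) = (\<Sum>s\<in>A. b v (f s))"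
  using module_hom.sum[of scale "(*)" "b v"] linear_b_right[of v] by (simp add: Vector_Spaces.linear_def)

lemma b_sum_left: "b (\<Sum>s\<in>A. f s) w = (\<Sum>s\<in>A. b (f s) w)"
  by (simp add: b_commute[of _ w] b_sum_right)

text \<open>\<open>e (prt s)\<close> is dual to \<open>e s\<close>, so pairing with it reads off the
  coordinate at \<open>e s\<close>.\<close>

lemma expand: "v = (\<Sum>s\<in>S. scale (b v (e (prt s))) (e s))"
proof -
  have "b (\<Sum>s\<in>S. scale (b v (e (prt s))) (e s)) (e t) = b v (e t)" if t: "t \<in> S" for t
  proof -
    have "b (\<Sum>s\<in>S. scale (b v (e (prt s))) (e s)) (e t) = (\<Sum>s\<in>S. b v (e (prt s)) * b (e s) (e t))"
      by (simp add: b_sum_left b_scale_left)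
    also have "\<dots> = (\<Sum>s\<in>S. if s = prt t then b v (e t) else 0)"
      using t by (intro sum.cong refl) (auto simp: b_e prt_prt prt_eq_swap)
    finally show ?thesis using t fin prt_in by simp
  qed
  then have "v - (\<Sum>s\<in>S. scale (b v (e (prt s))) (e s)) = 0"
    by (intro eq_zero_if_orthogonal) (simp add: b_diff_left)
  then show ?thesis by simp
qed

definition perm_map :: "('s \<Rightarrow> 's) \<Rightarrow> 'v \<Rightarrow> 'v"
  where "perm_map \<pi> v = (\<Sum>s\<in>S. scale (b v (e (prt s))) (e (\<pi> s)))"

lemma perm_map_linear: "Vector_Spaces.linear scale scale (perm_map \<pi>)"
proof -
  show ?thesis
    using vector_space_axioms module_axioms
    by (auto simp: Vector_Spaces.linear_def module_hom_iff perm_map_def b_add_left b_scale_left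
        scale_left_distrib sum.distrib scale_sum_right)
qed

lemma perm_map_e: "t \<in> S \<Longrightarrow> perm_map \<pi> (e t) = e (\<pi> t)"
proof -
  assume t: "t \<in> S"
  have "perm_map \<pi> (e t) = (\<Sum>s\<in>S. if s = t then e (\<pi> t) else 0)"
    unfolding perm_map_def using t by (intro sum.cong) (auto simp: b_e prt_in prt_eq_iff)
  then show ?thesis using t fin by simp
qed

context
  fixes \<pi>
  assumes \<pi>: "bij_betw \<pi> S S" and comm: "\<And>s. s \<in> S \<Longrightarrow> \<pi> (prt s) = prt (\<pi> s)"
begin

text \<open>Because \<pi> commutes with \<open>prt\<close>, the vectors \<open>e (\<pi> s)\<close>
  have the same Gram matrix as the vectors \<open>e s\<close>.\<close>

lemma perm_map_isometry: "b (perm_map \<pi> v) (perm_map \<pi> w) = b v w"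
proof -
  have \<pi>S: "\<pi> s \<in> S" if "s \<in> S" for s using \<pi> that by (auto simp: bij_betw_def)
  have *: "b (e (\<pi> s)) (e (\<pi> t)) = b (e s) (e t)" if "s \<in> S" "t \<in> S" for s t
    using that \<pi> comm[of s] inj_on_eq_iff[of \<pi> S t "prt s"]
    by (auto simp: b_e \<pi>S prt_in bij_betw_def)
  have left: "b (perm_map \<pi> v) (e (\<pi> t)) = b v (e t)" if t: "t \<in> S" for t
  proof -
    have "b (perm_map \<pi> v) (e (\<pi> t)) = (\<Sum>s\<in>S. b v (e (prt s)) * b (e s) (e t))"
      using t by (simp add: perm_map_def b_commute[of _ "e (\<pi> t)"] b_sum_right b_scale_right)
        (simp add: * b_commute)
    also have "\<dots> = b (\<Sum>s\<in>S. scale (b v (e (prt s))) (e s)) (e t)"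
      by (simp add: b_commute[of _ "e t"] b_sum_right b_scale_right)
    finally show ?thesis by (simp flip: expand)
  qed
  have "b (perm_map \<pi> v) (perm_map \<pi> w) = (\<Sum>s\<in>S. b w (e (prt s)) * b v (e s))"
    by (subst (2) perm_map_def) (simp add: b_sum_right b_scale_right left)
  also have "\<dots> = b v w"
    by (subst (2) expand[of w]) (simp add: b_sum_right b_scale_right)
  finally show ?thesis .
qed

lemma perm_map_bij: "bij (perm_map \<pi>)"
proof (rule bijI)
  interpret l: Vector_Spaces.linear scale scale "perm_map \<pi>" by (rule perm_map_linear)
  show "inj (perm_map \<pi>)"
  proof (rule injI)
    fix v w assume "perm_map \<pi> v = perm_map \<pi> w"
    then have "b (v - w) u = 0" for u
      using perm_map_isometry[of v u] perm_map_isometry[of w u] by (simp add: b_diff_left)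
    then show "v = w" using b_nondegenerate[of "v - w"] by simp
  qed
  show "surj (perm_map \<pi>)"
  proof (rule surjI)
    fix v
    \<comment> \<open>In this preimage the coordinate at \<open>e s\<close> is that of
      \<open>v\<close> at \<open>e (\<pi> s)\<close>.\<close>
    have "perm_map \<pi> (\<Sum>s\<in>S. scale (b v (e (prt (\<pi> s)))) (e s)) =
        (\<Sum>s\<in>S. scale (b v (e (prt (\<pi> s)))) (e (\<pi> s)))"
      by (simp add: l.sum l.scale perm_map_e)
    also have "\<dots> = v"
      using sum.reindex_bij_betw[OF \<pi>, of "\<lambda>s. scale (b v (e (prt s))) (e s)"] by (simp flip: expand)
    finally show "perm_map \<pi> (\<Sum>s\<in>S. scale (b v (e (prt (\<pi> s)))) (e s)) = v" .
  qed
qed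

end

lemma top_form_linear:
  assumes "i \<le> m"
  shows "Vector_Spaces.linear scale (*) (\<lambda>v. top_form (f(i := v)))"
proof (cases "i = m")
  case True
  have "X_fun (f(m := v)) = X_fun f" for v by (rule X_fun_cong) simp
  then show ?thesis using True linear_b_right by (simp add: top_form_def)
next
  case False
  then have "i < m" using assms by simp
  from X_fun_linear[OF this, of f] linear_b_left[of "f m"] False show ?thesis
    by (simp add: top_form_def Vector_Spaces.linear_def module_hom_iff)
qed

text \<open>Composing \<open>top_form\<close> with the linear map gives another alternating form of
  top degree, hence a multiple of it. The factor \<epsilon> is the determinant of
  \<open>perm_map \<pi>\<close>, obtained as the ratio of the values at two enumerations of the
  basis.\<close>

lemma top_form_perm_map:
  assumes \<pi>: "bij_betw \<pi> S S"
  obtains \<epsilon> where "\<epsilon> \<noteq> 0" "\<And>f. top_form (perm_map \<pi> \<circ> f) = \<epsilon> * top_form f"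
proof -
  let ?P = "perm_map \<pi>"
  from card_S have "S \<noteq> {}" by auto
  then obtain g where g: "bij_betw g {..m} S" using enumeration_ending_at by blast
  let ?c = "top_form (e \<circ> g)"
  have c: "?c \<noteq> 0" by (rule top_form_nonzero[OF g])
  have "X_fun (?P \<circ> (e \<circ> g)) = X_fun (e \<circ> (\<pi> \<circ> g))"
    by (intro X_fun_cong) (simp add: perm_map_e bij_betw_apply[OF g])
  moreover have "g m \<in> S" using g by (auto simp: bij_betw_def)
  ultimately have eq: "top_form (?P \<circ> (e \<circ> g)) = top_form (e \<circ> (\<pi> \<circ> g))"
    by (simp add: top_form_def perm_map_e)
  have d: "top_form (?P \<circ> (e \<circ> g)) \<noteq> 0"
    unfolding eq by (rule top_form_nonzero) (rule bij_betw_trans[OF g \<pi>])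
  let ?d = "top_form (?P \<circ> (e \<circ> g))"
  \<comment> \<open>This combination of the two forms vanishes at \<open>e \<circ> g\<close> by
    construction, so \<open>top_form_zero\<close> makes it vanish everywhere.\<close>
  have "top_form (?P \<circ> f) * ?c - top_form f * ?d = 0" for f
  proof (rule top_form_zero[where e = "e \<circ> g" and m = m
        and D = "\<lambda>f. top_form (?P \<circ> f) * ?c - top_form f * ?d"])
    show "Vector_Spaces.linear scale (*)
        (\<lambda>v. top_form (?P \<circ> f(i := v)) * ?c - top_form (f(i := v)) * ?d)" if "i \<le> m" for f i
    proof -
      have "?P \<circ> f(i := v) = (?P \<circ> f)(i := ?P v)" for v by auto
      with top_form_linear[OF that, of f] top_form_linear[OF that, of "?P \<circ> f"] perm_map_linear[of \<pi>]
      show ?thesis by (simp add: Vector_Spaces.linear_def module_hom_iff algebra_simps)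
    qed
    show "top_form (?P \<circ> f) * ?c - top_form f * ?d = 0" if "i < m" "f i = f m" for f i
      using X_fun_orthogonal[OF that(1), of f] X_fun_orthogonal[OF that(1), of "?P \<circ> f"] that(2)
      by (simp add: top_form_def)
    show "top_form (?P \<circ> f) * ?c - top_form f * ?d = top_form (?P \<circ> g) * ?c - top_form g * ?d"
      if "\<And>i. i \<le> m \<Longrightarrow> f i = g i" for f g
    proof -
      have "X_fun f = X_fun g" "X_fun (?P \<circ> f) = X_fun (?P \<circ> g)"
        using that by (auto intro!: X_fun_cong)
      with that[of m] show ?thesis by (simp add: top_form_def)
    qed
    show "span ((e \<circ> g) ` {..m}) = UNIV"
      using g span_e by (metis bij_betw_imp_surj_on image_comp)
    have "inj_on e S"
    proof (rule inj_onI)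
      fix s t assume st: "s \<in> S" "t \<in> S" "e s = e t"
      then have "b (e t) (e (prt s)) = 1" using b_e[of s "prt s"] prt_in by simp
      with st show "s = t" by (auto simp: b_e prt_in prt_eq_iff split: if_splits)
    qed
    with g show "inj_on (e \<circ> g) {..m}" by (auto simp: bij_betw_def intro: comp_inj_on)
  qed simp
  then have scaled: "top_form (?P \<circ> f) = (?d / ?c) * top_form f" for f using c by (simp add: field_simps)
  show ?thesis by (rule that[OF _ scaled]) (use c d in simp)
qed

text \<open>Being an isometry, \<open>?P\<close> turns the scaling of \<open>top_form\<close> into
  \<open>X (P v, ...) = \<epsilon> P (X (v, ...))\<close>. For \<phi> = \<open>c P\<close> the
  \<open>m\<close> arguments contribute \<open>c ^ m\<close>, so the condition on \<open>c\<close>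
  is \<open>c ^ m * \<epsilon> = c\<close>.\<close>

lemma Aut_realizing_permutation:
  assumes \<pi>: "bij_betw \<pi> S S" and comm: "\<And>s. s \<in> S \<Longrightarrow> \<pi> (prt s) = prt (\<pi> s)"
    and m: "m \<noteq> 0" and root: "\<And>c::'a. \<exists>y. y ^ (m - 1) = c"
  obtains \<phi> c where "\<phi> \<in> carrier (Aut scale m X)" "c \<noteq> 0"
    "\<And>s. s \<in> S \<Longrightarrow> \<phi> (e s) = scale c (e (\<pi> s))"
proof -
  let ?P = "perm_map \<pi>"
  interpret l: Vector_Spaces.linear scale scale ?P by (rule perm_map_linear)
  have \<pi>S: "\<pi> s \<in> S" if "s \<in> S" for s using \<pi> that by (auto simp: bij_betw_def)
  obtain \<epsilon> where \<epsilon>: "\<epsilon> \<noteq> 0" "\<And>f. top_form (?P \<circ> f) = \<epsilon> * top_form f"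
    using top_form_perm_map[OF \<pi>] by blast
  have XP: "X_fun (?P \<circ> f) = scale \<epsilon> (?P (X_fun f))" for f
  proof -
    have "b (X_fun (?P \<circ> f) - scale \<epsilon> (?P (X_fun f))) (e t) = 0" if "t \<in> S" for t
    proof -
      from \<pi> that obtain s where s: "s \<in> S" "t = \<pi> s" by (auto simp: bij_betw_def)
      \<comment> \<open>Slot \<open>m\<close> can be filled with any basis vector without altering
        the product, which allows testing against all of them.\<close>
      have "X_fun (?P \<circ> f(m := e s)) = X_fun (?P \<circ> f)" "X_fun (f(m := e s)) = X_fun f"
        by (auto intro: X_fun_cong)
      then have "b (X_fun (?P \<circ> f)) (?P (e s)) = \<epsilon> * b (X_fun f) (e s)"
        using \<epsilon>(2)[of "f(m := e s)"] by (simp add: top_form_def)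
      also have "\<dots> = b (scale \<epsilon> (?P (X_fun f))) (?P (e s))"
        by (simp add: b_scale_left perm_map_isometry[OF \<pi> comm])
      finally show ?thesis using s by (simp add: perm_map_e b_diff_left)
    qed
    then have "X_fun (?P \<circ> f) - scale \<epsilon> (?P (X_fun f)) = 0" by (rule eq_zero_if_orthogonal)
    then show ?thesis by simp
  qed
  obtain c where c: "c ^ (m - 1) = inverse \<epsilon> \<and> c \<noteq> 0"
  proof (cases "m = 1")
    \<comment> \<open>Contradictory: \<open>root\<close> would give a solution of
      \<open>y ^ 0 = 0\<close>.\<close>
    case True
    then show ?thesis using root[of 0] by simp
  next
    case False
    from root obtain y where y: "y ^ (m - 1) = inverse \<epsilon>" by blast
    moreover have "y \<noteq> 0"
    proof
      assume "y = 0"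
      with False m have "y ^ (m - 1) = 0" by simp
      with y \<epsilon>(1) show False by simp
    qed
    ultimately show ?thesis using that by blast
  qed
  define \<phi> where "\<phi> v = scale c (?P v)" for v
  have cm: "c ^ m * \<epsilon> = c" using c m \<epsilon>(1) by (cases m) (auto simp: field_simps)
  have "\<phi> \<in> carrier (Aut scale m X)"
    unfolding Aut_def
  proof (simp, intro conjI allI impI)
    show "Vector_Spaces.linear scale scale \<phi>"
      using perm_map_linear[of \<pi>]
      by (simp add: \<phi>_def Vector_Spaces.linear_def module_hom_iff scale_right_distrib mult.commute)
    show "bij \<phi>"
    proof -
      have "bij (scale c)" using c
        by (intro o_bij[of "scale (inverse c)"]) (auto simp: fun_eq_iff)
      moreover have "\<phi> = scale c \<circ> ?P" by (auto simp: \<phi>_def)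
      ultimately show ?thesis using perm_map_bij[OF \<pi> comm] by (simp add: bij_comp)
    qed
    fix vs :: "'v list" assume len: "length vs = m"
    then have vs: "vs = map (\<lambda>i. vs ! i) [0..<m]" by (simp add: map_nth flip: len)
    have "X (map \<phi> vs) = X_fun (\<lambda>i. scale c ((?P \<circ> (!) vs) i))"
      by (subst vs) (simp add: X_fun_def comp_def \<phi>_def)
    also have "\<dots> = scale (c ^ m * \<epsilon>) (?P (X_fun ((!) vs)))"
      unfolding X_fun_scale XP by simp
    also have "X_fun ((!) vs) = X vs" using vs by (simp add: X_fun_def)
    finally show "\<phi> (X vs) = X (map \<phi> vs)" unfolding cm \<phi>_def[symmetric] by (rule sym)
  qed
  with c that[of \<phi> c] show ?thesis by (simp add: \<phi>_def perm_map_e)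
qed

end

section \<open>Signed permutations as the permutations of the generators that commute with the
  partner map\<close>

text \<open>By the relations of \<open>U\<close>, if \<open>s\<close> has degree g then
  \<open>partner s\<close> has degree g^(-1) h, the only degree that \<open>b\<close> can pair with
  g.\<close>

fun partner :: "U_symbol \<Rightarrow> U_symbol" where
  "partner (XS i) = XS i"
| "partner (YS j) = ZS j"
| "partner (ZS j) = YS j"

text \<open>The swap is looked up at the destination \<tau> j, in agreement with the action chosen
  in the semidirect product.\<close>

fun symbol_perm :: "(nat \<Rightarrow> nat) \<times> (nat \<Rightarrow> int) \<times> (nat \<Rightarrow> nat) \<Rightarrow> U_symbol \<Rightarrow> U_symbol" where
  "symbol_perm (\<sigma>, \<epsilon>, \<tau>) (XS i) = XS (\<sigma> i)"
| "symbol_perm (\<sigma>, \<epsilon>, \<tau>) (YS j) = (if \<epsilon> (\<tau> j) = 0 then YS (\<tau> j) else ZS (\<tau> j))"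
| "symbol_perm (\<sigma>, \<epsilon>, \<tau>) (ZS j) = (if \<epsilon> (\<tau> j) = 0 then ZS (\<tau> j) else YS (\<tau> j))"

lemma partner_partner [simp]: "partner (partner s) = s"
  by (cases s) auto

lemma in_U_symbols [simp]:
  "XS i \<in> U_symbols p q \<longleftrightarrow> i \<in> {1..p}"
  "YS j \<in> U_symbols p q \<longleftrightarrow> j \<in> {1..q}"
  "ZS j \<in> U_symbols p q \<longleftrightarrow> j \<in> {1..q}"
  by (auto simp: U_symbols_def)

lemma partner_in_U_symbols [simp]: "partner s \<in> U_symbols p q \<longleftrightarrow> s \<in> U_symbols p q"
  by (cases s) auto

lemma finite_U_symbols [simp]: "finite (U_symbols p q)"
  by (simp add: U_symbols_def)

lemma card_U_symbols: "card (U_symbols p q) = p + 2 * q"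
proof -
  have "card (U_symbols p q) = card (XS ` {1..p}) + card (YS ` {1..q}) + card (ZS ` {1..q})"
    unfolding U_symbols_def by (subst card_Un_disjoint; (subst card_Un_disjoint)?) auto
  then show ?thesis by (simp add: card_image inj_on_def)
qed

abbreviation symbol_group :: "nat \<Rightarrow> nat \<Rightarrow> ((nat \<Rightarrow> nat) \<times> (nat \<Rightarrow> int) \<times> (nat \<Rightarrow> nat)) monoid"
  where "symbol_group p q \<equiv> sym_group p \<times>\<times> signed_permutation_group q"

lemma symbol_group_carrier:
  "(\<sigma>, \<epsilon>, \<tau>) \<in> carrier (symbol_group p q) \<longleftrightarrow>
     \<sigma> permutes {1..p} \<and> \<epsilon> \<in> {1..q} \<rightarrow>\<^sub>E {0, 1} \<and> \<tau> permutes {1..q}"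
proof -
  have "{0..<2::int} = {0, 1}" by auto
  then show ?thesis
    by (simp add: signed_permutation_group_def semidirect_product_def sym_group_def
        carrier_integer_mod_group)
qed

lemma symbol_group_mult:
  "(\<sigma>, \<epsilon>, \<tau>) \<otimes>\<^bsub>symbol_group p q\<^esub> (\<sigma>', \<epsilon>', \<tau>') =
     (\<sigma> \<circ> \<sigma>', (\<lambda>j\<in>{1..q}. (\<epsilon> j + \<epsilon>' (inv' \<tau> j)) mod 2), \<tau> \<circ> \<tau>')"
  by (auto simp: DirProd_def signed_permutation_group_def semidirect_product_def sym_group_def
      product_group_def restrict_def)

lemma symbol_group_one: "\<one>\<^bsub>symbol_group p q\<^esub> = (id, (\<lambda>j\<in>{1..q}. 0), id)"
  by (simp add: DirProd_def signed_permutation_group_def semidirect_product_def sym_group_def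
      product_group_def)

lemma symbol_group_one_closed: "\<one>\<^bsub>symbol_group p q\<^esub> \<in> carrier (symbol_group p q)"
  unfolding symbol_group_one symbol_group_carrier by (auto simp: permutes_id)

lemma symbol_group_mult_closed:
  assumes "x \<in> carrier (symbol_group p q)" "y \<in> carrier (symbol_group p q)"
  shows "x \<otimes>\<^bsub>symbol_group p q\<^esub> y \<in> carrier (symbol_group p q)"
proof -
  obtain \<sigma> \<epsilon> \<tau> \<sigma>' \<epsilon>' \<tau>' where xy: "x = (\<sigma>, \<epsilon>, \<tau>)" "y = (\<sigma>', \<epsilon>', \<tau>')" by (metis prod_cases3)
  show ?thesis
    using assms unfolding xy symbol_group_mult symbol_group_carrier
    by (auto simp: permutes_compose simp flip: One_nat_def)
qed

lemma symbol_perm_one: "s \<in> U_symbols p q \<Longrightarrow> symbol_perm \<one>\<^bsub>symbol_group p q\<^esub> s = s"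
  unfolding symbol_group_one by (cases s) auto

lemma symbol_perm_in:
  assumes "x \<in> carrier (symbol_group p q)" "s \<in> U_symbols p q"
  shows "symbol_perm x s \<in> U_symbols p q"
proof -
  obtain \<sigma> \<epsilon> \<tau> where x: "x = (\<sigma>, \<epsilon>, \<tau>)" by (metis prod_cases3)
  show ?thesis
    using assms unfolding x symbol_group_carrier
    by (cases s) (auto simp: permutes_in_image simp del: atLeastAtMost_iff)
qed

lemma symbol_perm_partner: "symbol_perm x (partner s) = partner (symbol_perm x s)"
  by (cases x; cases s) auto

lemma symbol_perm_mult:
  assumes "x \<in> carrier (symbol_group p q)" "y \<in> carrier (symbol_group p q)" "s \<in> U_symbols p q"
  shows "symbol_perm (x \<otimes>\<^bsub>symbol_group p q\<^esub> y) s = symbol_perm x (symbol_perm y s)"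
proof -
  obtain \<sigma> \<epsilon> \<tau> \<sigma>' \<epsilon>' \<tau>' where xy: "x = (\<sigma>, \<epsilon>, \<tau>)" "y = (\<sigma>', \<epsilon>', \<tau>')" by (metis prod_cases3)
  have perm: "\<tau> permutes {1..q}" "\<tau>' permutes {1..q}"
    and \<epsilon>: "\<epsilon> \<in> {1..q} \<rightarrow>\<^sub>E {0, 1}" "\<epsilon>' \<in> {1..q} \<rightarrow>\<^sub>E {0, 1}"
    using assms(1,2) unfolding xy symbol_group_carrier by auto
  have inv: "inv' \<tau> (\<tau> j) = j" for j using perm(1) by (simp add: permutes_inverses)
  have \<tau>: "\<tau> j \<in> {1..q} \<longleftrightarrow> j \<in> {1..q}" "\<tau>' j \<in> {1..q} \<longleftrightarrow> j \<in> {1..q}" for j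
    using perm by (auto simp: permutes_in_image simp del: atLeastAtMost_iff)
  have val: "\<epsilon> j = 0 \<or> \<epsilon> j = 1" "\<epsilon>' j = 0 \<or> \<epsilon>' j = 1" if "j \<in> {1..q}" for j
    using that \<epsilon> by (auto simp: PiE_iff)
  \<comment> \<open>At the destination \<tau> (\<tau>' j) the product group evaluates \<epsilon>' at
    the inverse image under \<tau>, which is \<tau>' j. So the signs of the two successive moves are
    added modulo 2: two swaps cancel.\<close>
  have pair: "symbol_perm (x \<otimes>\<^bsub>symbol_group p q\<^esub> y) s = symbol_perm x (symbol_perm y s)"
    if j: "j \<in> {1..q}" "s = YS j \<or> s = ZS j" for j
  proof -
    have "\<tau>' j \<in> {1..q}" "\<tau> (\<tau>' j) \<in> {1..q}" using j \<tau> by blast+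
    with val[of "\<tau> (\<tau>' j)"] val[of "\<tau>' j"] j(2) show ?thesis
      unfolding xy symbol_group_mult by (auto simp: inv simp del: atLeastAtMost_iff)
  qed
  show ?thesis
  proof (cases s)
    case (XS i)
    then show ?thesis unfolding xy symbol_group_mult by simp
  qed (use pair assms(3) in auto)
qed

lemma symbol_perm_inj:
  assumes "x \<in> carrier (symbol_group p q)" "y \<in> carrier (symbol_group p q)"
    and eq: "\<And>s. s \<in> U_symbols p q \<Longrightarrow> symbol_perm x s = symbol_perm y s"
  shows "x = y"
proof -
  obtain \<sigma> \<epsilon> \<tau> \<sigma>' \<epsilon>' \<tau>' where xy: "x = (\<sigma>, \<epsilon>, \<tau>)" "y = (\<sigma>', \<epsilon>', \<tau>')" by (metis prod_cases3)
  have perm: "\<sigma> permutes {1..p}" "\<sigma>' permutes {1..p}" "\<tau> permutes {1..q}" "\<tau>' permutes {1..q}"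
    and \<epsilon>: "\<epsilon> \<in> {1..q} \<rightarrow>\<^sub>E {0, 1}" "\<epsilon>' \<in> {1..q} \<rightarrow>\<^sub>E {0, 1}"
    using assms(1,2) unfolding xy symbol_group_carrier by auto
  have "\<sigma> i = \<sigma>' i" for i
    using eq[of "XS i"] perm(1,2) by (cases "i \<in> {1..p}") (auto simp: xy permutes_not_in)
  moreover have \<tau>: "\<tau> j = \<tau>' j" for j
    using eq[of "YS j"] perm(3,4)
    by (cases "j \<in> {1..q}") (auto simp: xy permutes_not_in split: if_splits)
  moreover have "\<epsilon> = \<epsilon>'"
  proof (rule PiE_ext[OF \<epsilon>])
    fix k assume k: "k \<in> {1..q}"
    then obtain j where j: "j \<in> {1..q}" "k = \<tau> j"
      using perm(3) by (metis permutes_image imageE)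
    have "\<epsilon> k = 0 \<or> \<epsilon> k = 1" "\<epsilon>' k = 0 \<or> \<epsilon>' k = 1" using k \<epsilon> by (auto simp: PiE_iff)
    with eq[of "YS j"] j \<tau> show "\<epsilon> k = \<epsilon>' k" by (auto simp: xy split: if_splits)
  qed
  ultimately show ?thesis by (auto simp: xy)
qed

lemma symbol_perm_bij:
  assumes x: "x \<in> carrier (symbol_group p q)"
  shows "bij_betw (symbol_perm x) (U_symbols p q) (U_symbols p q)"
proof -
  obtain \<sigma> \<epsilon> \<tau> where x': "x = (\<sigma>, \<epsilon>, \<tau>)" by (metis prod_cases3)
  have "inj \<sigma>" "inj \<tau>" using x unfolding x' symbol_group_carrier by (auto intro: permutes_inj)
  then have "symbol_perm x s = symbol_perm x t \<Longrightarrow> s = t" for s t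
    by (cases s; cases t) (auto simp: x' dest: injD split: if_splits)
  then have "inj_on (symbol_perm x) (U_symbols p q)" by (auto simp: inj_on_def)
  moreover have "symbol_perm x ` U_symbols p q \<subseteq> U_symbols p q" using symbol_perm_in[OF x] by auto
  ultimately show ?thesis by (simp add: bij_betw_def endo_inj_surj)
qed

text \<open>The orbits of \<open>partner\<close> are the single symbols \<open>XS i\<close> and the
  pairs \<open>YS j\<close>, \<open>ZS j\<close>. A permutation commuting with
  \<open>partner\<close> maps orbits to orbits of the same size, and on each pair it either keeps or
  exchanges the letters.\<close>

lemma symbol_perm_surj:
  assumes \<pi>: "bij_betw \<pi> (U_symbols p q) (U_symbols p q)"
    and comm: "\<And>s. s \<in> U_symbols p q \<Longrightarrow> \<pi> (partner s) = partner (\<pi> s)"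
  shows "\<exists>x\<in>carrier (symbol_group p q). \<forall>s\<in>U_symbols p q. \<pi> s = symbol_perm x s"
proof -
  have \<pi>S: "\<pi> s \<in> U_symbols p q" if "s \<in> U_symbols p q" for s using that \<pi> by (auto simp: bij_betw_def)
  have \<pi>_inj: "\<pi> s = \<pi> t \<longleftrightarrow> s = t" if "s \<in> U_symbols p q" "t \<in> U_symbols p q" for s t
    using that \<pi> by (auto simp: bij_betw_def inj_on_def)
  define idx where "idx s = (case s of XS i \<Rightarrow> i | YS j \<Rightarrow> j | ZS j \<Rightarrow> j)" for s
  define \<sigma> where "\<sigma> i = (if i \<in> {1..p} then idx (\<pi> (XS i)) else i)" for i
  define \<tau> where "\<tau> j = (if j \<in> {1..q} then idx (\<pi> (YS j)) else j)" for j
  have X: "\<pi> (XS i) = XS (\<sigma> i)" if "i \<in> {1..p}" for i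
  proof -
    have "partner (\<pi> (XS i)) = \<pi> (XS i)" using comm[of "XS i"] that by simp
    with that show ?thesis by (cases "\<pi> (XS i)") (auto simp: \<sigma>_def idx_def)
  qed
  have Y: "\<pi> (YS j) = YS (\<tau> j) \<and> \<pi> (ZS j) = ZS (\<tau> j) \<or> \<pi> (YS j) = ZS (\<tau> j) \<and> \<pi> (ZS j) = YS (\<tau> j)"
    if "j \<in> {1..q}" for j
  proof -
    have "\<pi> (ZS j) = partner (\<pi> (YS j))" using comm[of "YS j"] that by simp
    moreover have "\<pi> (ZS j) \<noteq> \<pi> (YS j)" using \<pi>_inj[of "ZS j" "YS j"] that by simp
    ultimately show ?thesis using that by (cases "\<pi> (YS j)") (auto simp: \<tau>_def idx_def)
  qed
  have "\<sigma> permutes {1..p}"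
  proof (rule bij_imp_permutes)
    have "inj_on \<sigma> {1..p}"
    proof (rule inj_onI)
      fix i j assume "i \<in> {1..p}" "j \<in> {1..p}" "\<sigma> i = \<sigma> j"
      with X \<pi>_inj[of "XS i" "XS j"] show "i = j" by simp
    qed
    moreover have "\<sigma> i \<in> {1..p}" if "i \<in> {1..p}" for i
      using \<pi>S[of "XS i"] X[OF that] that by simp
    then have "\<sigma> ` {1..p} \<subseteq> {1..p}" by blast
    ultimately show "bij_betw \<sigma> {1..p} {1..p}"
      by (simp add: bij_betw_def endo_inj_surj)
  qed (auto simp: \<sigma>_def)
  moreover have \<tau>: "\<tau> permutes {1..q}"
  proof (rule bij_imp_permutes)
    have "inj_on \<tau> {1..q}"
    proof (rule inj_onI)
      fix i j assume ij: "i \<in> {1..q}" "j \<in> {1..q}" "\<tau> i = \<tau> j"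
      then have "\<pi> (YS i) = \<pi> (YS j) \<or> \<pi> (YS i) = \<pi> (ZS j)" using Y[of i] Y[of j] by auto
      with ij \<pi>_inj[of "YS i" "YS j"] \<pi>_inj[of "YS i" "ZS j"] show "i = j" by auto
    qed
    moreover have "\<tau> j \<in> {1..q}" if "j \<in> {1..q}" for j
      using \<pi>S[of "YS j"] Y[OF that] that by auto
    then have "\<tau> ` {1..q} \<subseteq> {1..q}" by blast
    ultimately show "bij_betw \<tau> {1..q} {1..q}"
      by (simp add: bij_betw_def endo_inj_surj)
  qed (auto simp: \<tau>_def)
  \<comment> \<open>Signs are indexed by the destination pair \<open>k\<close>, so the letter is
    checked at the pair that \<tau> sends there.\<close>
  moreover define \<epsilon> where
    "\<epsilon> = (\<lambda>k\<in>{1..q}. if \<pi> (YS (inv' \<tau> k)) = YS k then 0 else 1 :: int)"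
  have \<epsilon>: "\<epsilon> (\<tau> j) = (if \<pi> (YS j) = YS (\<tau> j) then 0 else 1)" if "j \<in> {1..q}" for j
    using that \<tau> by (simp add: \<epsilon>_def permutes_inverses permutes_in_image del: atLeastAtMost_iff)
  moreover have "\<epsilon> \<in> {1..q} \<rightarrow>\<^sub>E {0, 1}" by (simp add: \<epsilon>_def)
  ultimately have "(\<sigma>, \<epsilon>, \<tau>) \<in> carrier (symbol_group p q)" unfolding symbol_group_carrier by simp
  moreover have "\<pi> s = symbol_perm (\<sigma>, \<epsilon>, \<tau>) s" if "s \<in> U_symbols p q" for s
  proof (cases s)
    case (YS j)
    with that Y[of j] \<epsilon>[of j] show ?thesis by auto
  next
    case (ZS j)
    with that Y[of j] \<epsilon>[of j] show ?thesis by auto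
  qed (use that X in auto)
  ultimately show ?thesis by blast
qed

section \<open>Products of degrees in \<open>U\<close>\<close>

lemma U_relators_subset: "U_relators p q \<subseteq> carrier (free_Abelian_group (U_symbols p q))"
proof -
  interpret comm_group "free_Abelian_group (U_symbols p q)" by (rule abelian_free_Abelian_group)
  have t: "(\<Sum>s\<in>U_symbols p q. frag_of s) \<in> carrier (free_Abelian_group (U_symbols p q))"
    by (rule sum_closed_free_Abelian_group) simp
  have "frag_of s + frag_of s' - (\<Sum>s\<in>U_symbols p q. frag_of s) \<in> carrier (free_Abelian_group (U_symbols p q))"
    if "s \<in> U_symbols p q" "s' \<in> U_symbols p q" for s s'
  proof -
    have "frag_of s + frag_of s' \<in> carrier (free_Abelian_group (U_symbols p q))"
      using m_closed[of "frag_of s" "frag_of s'"] that by simp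
    from m_closed[OF this inv_closed[OF t]] t show ?thesis by simp
  qed
  then show ?thesis by (auto simp: U_relators_def Let_def)
qed

abbreviation U_kernel :: "nat \<Rightarrow> nat \<Rightarrow> (U_symbol \<Rightarrow>\<^sub>0 int) set"
  where "U_kernel p q \<equiv> generate (free_Abelian_group (U_symbols p q)) (U_relators p q)"

abbreviation U_coset :: "nat \<Rightarrow> nat \<Rightarrow> (U_symbol \<Rightarrow>\<^sub>0 int) \<Rightarrow> (U_symbol \<Rightarrow>\<^sub>0 int) set"
  where "U_coset p q u \<equiv> U_kernel p q #>\<^bsub>free_Abelian_group (U_symbols p q)\<^esub> u"

lemma U_kernel_normal: "normal (U_kernel p q) (free_Abelian_group (U_symbols p q))"
proof -
  interpret comm_group "free_Abelian_group (U_symbols p q)" by (rule abelian_free_Abelian_group)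
  show ?thesis
    using generate_is_subgroup[OF U_relators_subset] normal_iff_subgroup by blast
qed

lemma U_group_comm_group: "comm_group (U_group p q)"
proof -
  interpret comm_group "free_Abelian_group (U_symbols p q)" by (rule abelian_free_Abelian_group)
  show ?thesis unfolding U_group_def presented_abelian_group_def
    by (rule abelian_FactGroup[OF generate_is_subgroup[OF U_relators_subset]])
qed

lemma U_coset_hom: "U_coset p q \<in> hom (free_Abelian_group (U_symbols p q)) (U_group p q)"
  unfolding U_group_def presented_abelian_group_def
  by (rule normal.r_coset_hom_Mod[OF U_kernel_normal])

lemma U_gen_eq_U_coset: "U_gen p q s = U_coset p q (frag_of s)"
  by (simp add: U_gen_def presented_gen_def)

lemma U_gen_closed: "s \<in> U_symbols p q \<Longrightarrow> U_gen p q s \<in> carrier (U_group p q)"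
  unfolding U_gen_eq_U_coset using hom_in_carrier[OF U_coset_hom] by simp

lemma U_coset_sum:
  assumes "A \<subseteq> U_symbols p q"
  shows "U_coset p q (\<Sum>s\<in>A. frag_of s) = finprod (U_group p q) (U_gen p q) A"
proof -
  interpret U: comm_group "U_group p q" by (rule U_group_comm_group)
  have "finite A" using assms finite_U_symbols finite_subset by blast
  then show ?thesis using assms
  proof (induction A rule: finite_induct)
    case empty
    have "U_coset p q \<one>\<^bsub>free_Abelian_group (U_symbols p q)\<^esub> = \<one>\<^bsub>U_group p q\<^esub>"
      by (rule hom_one[OF U_coset_hom]) (simp_all add: U.is_group)
    then show ?case by simp
  next
    case (insert s A)
    have "(\<Sum>s\<in>A. frag_of s) \<in> carrier (free_Abelian_group (U_symbols p q))"
      using insert.prems by (intro sum_closed_free_Abelian_group) auto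
    moreover have "frag_of s \<in> carrier (free_Abelian_group (U_symbols p q))"
      using insert.prems by simp
    ultimately have "U_coset p q (frag_of s \<otimes>\<^bsub>free_Abelian_group (U_symbols p q)\<^esub> (\<Sum>s\<in>A. frag_of s)) =
        U_coset p q (frag_of s) \<otimes>\<^bsub>U_group p q\<^esub> U_coset p q (\<Sum>s\<in>A. frag_of s)"
      by (intro hom_mult[OF U_coset_hom])
    also have "\<dots> = finprod (U_group p q) (U_gen p q) (insert s A)"
      using insert U_gen_closed by (simp add: U_gen_eq_U_coset[symmetric] Pi_iff subset_iff)
    finally show ?case using insert.hyps by simp
  qed
qed

lemma U_coset_eq:
  assumes u: "u \<in> carrier (free_Abelian_group (U_symbols p q))"
    and w: "w \<in> carrier (free_Abelian_group (U_symbols p q))" and R: "u - w \<in> U_relators p q"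
  shows "U_coset p q u = U_coset p q w"
proof -
  interpret F: comm_group "free_Abelian_group (U_symbols p q)" by (rule abelian_free_Abelian_group)
  interpret N: normal "U_kernel p q" "free_Abelian_group (U_symbols p q)" by (rule U_kernel_normal)
  have "u - w \<in> U_kernel p q" using R by (rule generate.incl)
  moreover have "u = (u - w) \<otimes>\<^bsub>free_Abelian_group (U_symbols p q)\<^esub> w" by simp
  ultimately have "u \<in> U_coset p q w" unfolding r_coset_def by blast
  then show ?thesis using F.repr_independence[OF _ w N.subgroup_axioms] by simp
qed

lemma U_gen_mult_partner:
  assumes s: "s \<in> U_symbols p q"
  shows "U_gen p q s \<otimes>\<^bsub>U_group p q\<^esub> U_gen p q (partner s) =
    finprod (U_group p q) (U_gen p q) (U_symbols p q)"
proof -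
  let ?F = "free_Abelian_group (U_symbols p q)"
  interpret F: comm_group ?F by (rule abelian_free_Abelian_group)
  let ?t = "\<Sum>s\<in>U_symbols p q. frag_of s"
  have mem: "frag_of s \<in> carrier ?F" "frag_of (partner s) \<in> carrier ?F" using s by simp_all
  have "frag_of s + frag_of (partner s) - ?t \<in> U_relators p q"
    using s by (cases s) (auto simp: U_relators_def Let_def add.commute)
  moreover have "frag_of s + frag_of (partner s) \<in> carrier ?F"
    using F.m_closed[OF mem] by simp
  moreover have "?t \<in> carrier ?F" by (rule sum_closed_free_Abelian_group) simp
  ultimately have "U_coset p q (frag_of s + frag_of (partner s)) = U_coset p q ?t"
    by (intro U_coset_eq)
  moreover have "U_coset p q (frag_of s + frag_of (partner s)) =
      U_gen p q s \<otimes>\<^bsub>U_group p q\<^esub> U_gen p q (partner s)"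
    unfolding U_gen_eq_U_coset using hom_mult[OF U_coset_hom mem] by simp
  ultimately show ?thesis by (simp add: U_coset_sum)
qed

text \<open>This is the element h of \<Gamma>(G, \<delta>). The carrier may be infinite, but only
  generators contribute; injectivity ensures that each of them is counted once per symbol.\<close>

lemma gfinprod_delta_U:
  assumes inj: "inj_on (U_gen p q) (U_symbols p q)"
  shows "gfinprod (U_group p q) (\<lambda>k. k [^]\<^bsub>U_group p q\<^esub> delta_U p q k) (carrier (U_group p q)) =
    finprod (U_group p q) (U_gen p q) (U_symbols p q)"
proof -
  interpret U: comm_group "U_group p q" by (rule U_group_comm_group)
  let ?f = "\<lambda>k. k [^]\<^bsub>U_group p q\<^esub> delta_U p q k" and ?I = "U_gen p q ` U_symbols p q"
  have "?I \<subseteq> carrier (U_group p q)" using U_gen_closed by auto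
  then have f: "?f \<in> ?I \<rightarrow> carrier (U_group p q)" by auto
  have "gfinprod (U_group p q) ?f (carrier (U_group p q)) = gfinprod (U_group p q) ?f ?I"
    using \<open>?I \<subseteq> _\<close> by (intro U.gfinprod_mono_neutral_cong_right) (auto simp: delta_U_def)
  also have "\<dots> = finprod (U_group p q) ?f ?I"
    using f by (intro U.gfinprod_eq_finprod) auto
  also have "\<dots> = finprod (U_group p q) (\<lambda>s. ?f (U_gen p q s)) (U_symbols p q)"
    using f inj by (intro U.finprod_reindex)
  also have "\<dots> = finprod (U_group p q) (U_gen p q) (U_symbols p q)"
    using U_gen_closed by (intro U.finprod_cong') (auto simp: delta_U_def)
  finally show ?thesis .
qed

text \<open>With h as the product of all generators, this says which homogeneous components
  \<open>b\<close> may pair nontrivially: that of \<open>s\<close> with that of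
  \<open>partner s\<close> alone.\<close>

lemma U_gen_mult_eq_iff:
  assumes inj: "inj_on (U_gen p q) (U_symbols p q)" and st: "s \<in> U_symbols p q" "t \<in> U_symbols p q"
  shows "U_gen p q s \<otimes>\<^bsub>U_group p q\<^esub> U_gen p q t =
    finprod (U_group p q) (U_gen p q) (U_symbols p q) \<longleftrightarrow> t = partner s"
proof -
  interpret U: comm_group "U_group p q" by (rule U_group_comm_group)
  have "U_gen p q s \<otimes>\<^bsub>U_group p q\<^esub> U_gen p q t = U_gen p q s \<otimes>\<^bsub>U_group p q\<^esub> U_gen p q (partner s)
      \<longleftrightarrow> U_gen p q t = U_gen p q (partner s)"
    using st U.Units_eq by (intro U.Units_l_cancel) (simp_all add: U_gen_closed)
  then show ?thesis
    using inj st by (simp add: U_gen_mult_partner inj_on_eq_iff)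
qed

section \<open>The group of automorphisms permuting the components\<close>

lemma Aut_grading_carrier:
  "\<phi> \<in> carrier (Aut_grading scale r X G \<Gamma>) \<longleftrightarrow>
    \<phi> \<in> carrier (Aut scale r X) \<and> bij_betw ((`) \<phi>) (components G \<Gamma>) (components G \<Gamma>)"
  by (simp add: Aut_grading_def)

lemma Aut_carrier:
  "\<phi> \<in> carrier (Aut scale r X) \<longleftrightarrow> Vector_Spaces.linear scale scale \<phi> \<and> bij \<phi> \<and>
    (\<forall>vs. length vs = r \<longrightarrow> \<phi> (X vs) = X (map \<phi> vs))"
  by (simp add: Aut_def)

lemma Aut_grading_simps [simp]:
  "x \<otimes>\<^bsub>Aut_grading scale r X G \<Gamma>\<^esub> y = x \<circ> y" "\<one>\<^bsub>Aut_grading scale r X G \<Gamma>\<^esub> = id"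
  by (simp_all add: Aut_grading_def Aut_def)

lemma linear_inv_if_bij:
  assumes lin: "Vector_Spaces.linear scale scale \<phi>" and bij: "bij \<phi>"
  shows "Vector_Spaces.linear scale scale (inv' \<phi>)"
proof -
  interpret Vector_Spaces.linear scale scale \<phi> by (rule lin)
  have 1: "\<phi> (inv' \<phi> v) = v" "inv' \<phi> (\<phi> v) = v" for v
    using bij by (simp_all add: bij_is_surj surj_f_inv_f bij_is_inj inv_f_f)
  have "inv' \<phi> (v + w) = inv' \<phi> v + inv' \<phi> w" for v w
    using 1(2)[of "inv' \<phi> v + inv' \<phi> w"] by (simp add: add 1)
  moreover have "inv' \<phi> (scale c v) = scale c (inv' \<phi> v)" for c v
    using 1(2)[of "scale c (inv' \<phi> v)"] by (simp add: local.scale 1)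
  ultimately show ?thesis
    using lin by (simp add: Vector_Spaces.linear_def module_hom_iff)
qed

lemma group_Aut_grading:
  assumes "vector_space scale"
  shows "group (Aut_grading scale r X G \<Gamma>)"
proof (rule groupI)
  interpret vector_space scale by fact
  let ?A = "Aut_grading scale r X G \<Gamma>"
  have comp: "((`) \<phi>) \<circ> ((`) \<psi>) = (`) (\<phi> \<circ> \<psi>)" for \<phi> \<psi> :: "'b \<Rightarrow> 'b"
    by (auto simp: image_comp)
  show "\<phi> \<otimes>\<^bsub>?A\<^esub> \<psi> \<in> carrier ?A" if "\<phi> \<in> carrier ?A" "\<psi> \<in> carrier ?A" for \<phi> \<psi>
  proof -
    have "bij_betw ((`) (\<phi> \<circ> \<psi>)) (components G \<Gamma>) (components G \<Gamma>)"
      using that unfolding Aut_grading_carrier comp[symmetric] by (blast intro: bij_betw_trans)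
    with that show ?thesis
      unfolding Aut_grading_carrier Aut_carrier Aut_grading_simps
      by (auto intro: Vector_Spaces.linear_compose bij_comp)
  qed
  have "Vector_Spaces.linear scale scale id"
    using vector_space_axioms module_axioms by (simp add: Vector_Spaces.linear_def module_hom_iff)
  then show "\<one>\<^bsub>?A\<^esub> \<in> carrier ?A"
    unfolding Aut_grading_carrier Aut_carrier by (simp add: bij_betw_def inj_on_def)
  show "\<exists>\<psi>\<in>carrier ?A. \<psi> \<otimes>\<^bsub>?A\<^esub> \<phi> = \<one>\<^bsub>?A\<^esub>" if \<phi>: "\<phi> \<in> carrier ?A" for \<phi>
  proof (rule bexI)
    let ?\<psi> = "inv' \<phi>"
    have lin: "Vector_Spaces.linear scale scale \<phi>" and bij: "bij \<phi>"
      and X: "\<And>vs. length vs = r \<Longrightarrow> \<phi> (X vs) = X (map \<phi> vs)"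
      and C: "bij_betw ((`) \<phi>) (components G \<Gamma>) (components G \<Gamma>)"
      using \<phi> unfolding Aut_grading_carrier Aut_carrier by auto
    have inv: "\<phi> \<circ> ?\<psi> = id" "?\<psi> \<circ> \<phi> = id"
      using bij by (simp_all add: fun_eq_iff bij_is_surj surj_f_inv_f bij_is_inj)
    then show "?\<psi> \<otimes>\<^bsub>?A\<^esub> \<phi> = \<one>\<^bsub>?A\<^esub>" by simp
    have "?\<psi> (X vs) = X (map ?\<psi> vs)" if "length vs = r" for vs
    proof -
      have "map \<phi> (map ?\<psi> vs) = vs" unfolding map_map inv by simp
      then have "\<phi> (X (map ?\<psi> vs)) = X vs" using X[of "map ?\<psi> vs"] that by simp
      then show ?thesis using bij by (metis bij_inv_eq_iff)
    qed
    moreover have "bij_betw ((`) ?\<psi>) (components G \<Gamma>) (components G \<Gamma>)"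
    proof (rule bij_betw_byWitness[where f' = "(`) \<phi>"])
      have *: "?\<psi> ` (\<phi> ` W) = W" "\<phi> ` (?\<psi> ` W) = W" for W
        unfolding image_comp inv by simp_all
      then show "\<forall>W\<in>components G \<Gamma>. \<phi> ` (?\<psi> ` W) = W" "\<forall>W\<in>components G \<Gamma>. ?\<psi> ` (\<phi> ` W) = W"
        by auto
      show "(`) \<phi> ` components G \<Gamma> \<subseteq> components G \<Gamma>" using C by (simp add: bij_betw_def)
      show "(`) ?\<psi> ` components G \<Gamma> \<subseteq> components G \<Gamma>"
      proof
        fix W assume "W \<in> (`) ?\<psi> ` components G \<Gamma>"
        then obtain W' where "W' \<in> components G \<Gamma>" "W = ?\<psi> ` W'" by auto
        moreover from this C obtain W'' where "W'' \<in> components G \<Gamma>" "W' = \<phi> ` W''"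
          by (metis bij_betw_imp_surj_on imageE)
        ultimately show "W \<in> components G \<Gamma>" using * by simp
      qed
    qed
    ultimately show "?\<psi> \<in> carrier ?A"
      unfolding Aut_grading_carrier Aut_carrier
      using linear_inv_if_bij[OF lin bij] bij_imp_bij_inv[OF bij] by auto
  qed
qed (auto simp: comp_assoc)

section \<open>A normalised homogeneous basis\<close>

text \<open>Only degrees of generators carry nonzero components, and these are lines. As the lines
  span a space of dimension \<open>n\<close>, there are at least \<open>n\<close> such degrees,
  which forces the \<open>n\<close> symbols to have distinct images in \<open>U\<close>.\<close>

lemma exists_homogeneous_basis:
  fixes scale :: "'a::alg_closed_field \<Rightarrow> 'v::ab_group_add \<Rightarrow> 'v"
  assumes char: "CHAR('a) \<noteq> 2" and n: "n \<ge> 3" and V: "vector_space scale"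
    and dim: "vector_space.dim scale (UNIV :: 'v set) = n"
    and form: "nondegenerate_symmetric_bilinear_form scale b"
    and cross: "cross_product scale (n - 1) b X"
    and pq: "p + 2 * q = n"
    and Gamma: "is_Gamma scale (n - 1) b X (U_group p q) (delta_U p q) \<Gamma>"
  obtains e where "cross_product_basis scale b X (n - 1) (U_symbols p q) e partner"
    "\<And>s. s \<in> U_symbols p q \<Longrightarrow> \<Gamma> (U_gen p q s) = module.span scale {e s}"
    "components (U_group p q) \<Gamma> = (\<lambda>s. \<Gamma> (U_gen p q s)) ` U_symbols p q"
proof -
  interpret vector_space scale by (rule V)
  let ?S = "U_symbols p q" and ?gen = "U_gen p q" and ?U = "U_group p q"
  note gen_closed = U_gen_closed[of _ p q]
  have decomp: "direct_sum_decomposition scale (carrier ?U) \<Gamma>"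
    and dims: "\<And>g. g \<in> carrier ?U \<Longrightarrow> dim (\<Gamma> g) = delta_U p q g"
    and orth: "\<And>g g' v w. \<lbrakk>g \<in> carrier ?U; g' \<in> carrier ?U; v \<in> \<Gamma> g; w \<in> \<Gamma> g';
      g \<otimes>\<^bsub>?U\<^esub> g' \<noteq> gfinprod ?U (\<lambda>k. k [^]\<^bsub>?U\<^esub> delta_U p q k) (carrier ?U)\<rbrakk> \<Longrightarrow> b v w = 0"
    using Gamma unfolding is_Gamma_def grading_def by blast+
  have sub: "subspace (\<Gamma> g)" if "g \<in> carrier ?U" for g
    using decomp that by (simp add: direct_sum_decomposition_def)
  obtain B0 where B0: "UNIV \<subseteq> span B0" "card B0 = n" using basis_exists[of UNIV] dim by metis
  have fin0: "finite B0" using B0(2) n by (intro card_ge_0_finite) simp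
  have zero: "\<Gamma> g = {0}" if g: "g \<in> carrier ?U" "g \<notin> ?gen ` ?S" for g
  proof -
    obtain B where B: "B \<subseteq> \<Gamma> g" "independent B" "\<Gamma> g \<subseteq> span B" "card B = dim (\<Gamma> g)"
      by (rule basis_exists)
    \<comment> \<open>An infinite basis would also have \<open>card\<close> 0, so dimension 0 means
      the zero space only once finiteness is known.\<close>
    have "finite B" using independent_span_bound[OF fin0 B(2)] B0(1) by auto
    with B(4) dims[OF g(1)] g(2) have "B = {}" by (simp add: delta_U_def)
    with B(3) subspace_0[OF sub[OF g(1)]] show ?thesis by auto
  qed
  have "\<exists>w. w \<noteq> 0 \<and> \<Gamma> g = span {w}" if g: "g \<in> ?gen ` ?S" for g
  proof -
    have gU: "g \<in> carrier ?U" using g gen_closed by auto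
    obtain B where B: "B \<subseteq> \<Gamma> g" "independent B" "\<Gamma> g \<subseteq> span B" "card B = dim (\<Gamma> g)"
      by (rule basis_exists)
    with dims[OF gU] g have "card B = 1" by (simp add: delta_U_def)
    then obtain w where w: "B = {w}" by (rule card_1_singletonE)
    with B(2) have "w \<noteq> 0" using dependent_zero by auto
    moreover have "\<Gamma> g = span {w}"
      using B(1,3) w span_minimal[OF B(1) sub[OF gU]] by auto
    ultimately show ?thesis by blast
  qed
  then obtain w where w: "\<And>g. g \<in> ?gen ` ?S \<Longrightarrow> w g \<noteq> 0 \<and> \<Gamma> g = span {w g}" by metis
  have span_w: "span (w ` ?gen ` ?S) = UNIV"
  proof -
    have "v \<in> span (w ` ?gen ` ?S)" for v
    proof -
      obtain f where f: "\<And>i. i \<in> carrier ?U \<Longrightarrow> f i \<in> \<Gamma> i" "\<And>i. i \<notin> carrier ?U \<Longrightarrow> f i = 0"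
        and v: "v = (\<Sum>i | f i \<noteq> 0. f i)"
      proof -
        from decomp have "\<exists>!f. (\<forall>i\<in>carrier ?U. f i \<in> \<Gamma> i) \<and> (\<forall>i. i \<notin> carrier ?U \<longrightarrow> f i = 0) \<and>
            finite {i. f i \<noteq> 0} \<and> v = (\<Sum>i | f i \<noteq> 0. f i)"
          unfolding direct_sum_decomposition_def by (elim conjE) (erule spec)
        then show ?thesis using that by (elim ex1E) blast
      qed
      show ?thesis unfolding v
      proof (rule span_sum)
        fix i assume i: "i \<in> {i. f i \<noteq> 0}"
        then have iU: "i \<in> carrier ?U" using f(2) by auto
        with i f(1) zero have ig: "i \<in> ?gen ` ?S" by blast
        then have "f i \<in> span {w i}" using f(1)[OF iU] w by auto
        moreover have "span {w i} \<subseteq> span (w ` ?gen ` ?S)" using ig by (intro span_mono) auto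
        ultimately show "f i \<in> span (w ` ?gen ` ?S)" by blast
      qed
    qed
    then show ?thesis by auto
  qed
  have inj: "inj_on ?gen ?S"
  proof (rule eq_card_imp_inj_on)
    have "n \<le> card (w ` ?gen ` ?S)" unfolding dim[symmetric] by (rule dim_le_card) (simp_all add: span_w)
    also have "\<dots> \<le> card (?gen ` ?S)" by (rule card_image_le) simp
    finally show "card (?gen ` ?S) = card ?S"
      using card_image_le[of ?S ?gen] pq by (simp add: card_U_symbols)
  qed simp
  define u where "u s = w (?gen s)" for s
  have u: "u s \<noteq> 0" "\<Gamma> (?gen s) = span {u s}" if "s \<in> ?S" for s using w that by (auto simp: u_def)
  have span_u: "span (u ` ?S) = UNIV" using span_w by (simp add: u_def image_image)
  have b_u: "b (u s) (u t) = 0" if "s \<in> ?S" "t \<in> ?S" "t \<noteq> partner s" for s t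
    using that u(2) by (intro orth[of "?gen s" "?gen t"])
      (simp_all add: gen_closed span_base gfinprod_delta_U[OF inj] U_gen_mult_eq_iff[OF inj])
  have lin_b: "Vector_Spaces.linear scale (*) (b v)" "Vector_Spaces.linear scale (*) (\<lambda>v. b v v')"
    and b_comm: "b v v' = b v' v" and nondeg: "(\<And>w. b v w = 0) \<Longrightarrow> v = 0" for v v'
    using form by (auto simp: nondegenerate_symmetric_bilinear_form_def)
  define \<beta> where "\<beta> s = b (u s) (u (partner s))" for s
  \<comment> \<open>\<open>u s\<close> is orthogonal to every other basis vector, so a zero here
    would put it in the radical of \<open>b\<close>.\<close>
  have \<beta>: "\<beta> s \<noteq> 0" if s: "s \<in> ?S" for s
  proof
    assume "\<beta> s = 0"
    then have 0: "b (u s) v = 0" if "v \<in> u ` ?S" for v using that b_u s by (auto simp: \<beta>_def)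
    have "b (u s) v = 0" for v
    proof -
      interpret Vector_Spaces.linear scale "(*)" "b (u s)" by (rule lin_b)
      show ?thesis by (rule eq_0_on_span[of "u ` ?S"]) (use 0 span_u in auto)
    qed
    with nondeg u(1)[OF s] show False by blast
  qed
  \<comment> \<open>Partners thus share one value and one chosen square root. Dividing each of the
    two vectors by that root divides their pairing by \<beta>.\<close>
  have \<beta>_partner: "\<beta> (partner s) = \<beta> s" for s by (simp add: \<beta>_def b_comm)
  have "\<exists>y. y ^ 2 = x" for x :: 'a by (rule nth_root_exists) simp
  then obtain r where r: "\<And>x::'a. r x ^ 2 = x" by metis
  have r0: "r (\<beta> s) \<noteq> 0" if "s \<in> ?S" for s using r[of "\<beta> s"] \<beta>[OF that] by auto
  define e where "e s = scale (inverse (r (\<beta> s))) (u s)" for s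
  have u_e: "u s = scale (r (\<beta> s)) (e s)" if "s \<in> ?S" for s using r0[OF that] by (simp add: e_def)
  have b_e: "b (e s) (e t) = (if t = partner s then 1 else 0)" if st: "s \<in> ?S" "t \<in> ?S" for s t
  proof -
    have "b (e s) (e t) = inverse (r (\<beta> s)) * (inverse (r (\<beta> t)) * b (u s) (u t))"
      using lin_b(1)[of "e s"] lin_b(2)[of "u t"]
      by (simp add: e_def Vector_Spaces.linear_def module_hom_iff)
    also have "\<dots> = (if t = partner s then 1 else 0)"
    proof (cases "t = partner s")
      case True
      have "inverse (r (\<beta> s)) * (inverse (r (\<beta> s)) * r (\<beta> s) ^ 2) = 1"
        using r0[OF st(1)] by (simp add: power2_eq_square field_simps)
      with True show ?thesis by (simp add: \<beta>_partner r) (simp add: \<beta>_def)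
    qed (use b_u st in simp)
    finally show ?thesis .
  qed
  have span_single: "\<Gamma> (?gen s) = span {e s}" if s: "s \<in> ?S" for s
  proof -
    have "e s \<in> span {u s}" by (simp add: e_def span_scale span_base)
    moreover have "u s \<in> span {e s}" using u_e[OF s] by (simp add: span_scale span_base)
    ultimately show ?thesis unfolding u(2)[OF s] by (simp add: span_eq)
  qed
  have span_e: "span (e ` ?S) = UNIV"
  proof -
    have "u ` ?S \<subseteq> span (e ` ?S)" using u_e by (auto intro!: span_scale intro: span_base)
    then have "span (u ` ?S) \<subseteq> span (e ` ?S)" by (rule span_minimal) simp
    with span_u show ?thesis by auto
  qed
  have two: "(2::'a) \<noteq> 0"
  proof
    assume "(2::'a) = 0"
    then have "of_nat 2 = (0::'a)" by simp
    then have "CHAR('a) dvd 2" by (simp only: of_nat_eq_0_iff_char_dvd)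
    then have "CHAR('a) = 1 \<or> CHAR('a) = 2" using two_is_prime_nat by (metis prime_nat_iff)
    moreover have "CHAR('a) \<noteq> 1" by (simp add: CHAR_not_1)
    ultimately show False using char by blast
  qed
  have basis: "cross_product_basis scale b X (n - 1) ?S e partner"
    by unfold_locales (use two form cross span_e b_e pq n in \<open>auto simp: card_U_symbols\<close>)
  have comps: "components ?U \<Gamma> = (\<lambda>s. \<Gamma> (?gen s)) ` ?S"
  proof (intro equalityI subsetI)
    fix W assume "W \<in> components ?U \<Gamma>"
    then obtain g where g: "W = \<Gamma> g" "g \<in> carrier ?U" "\<Gamma> g \<noteq> {0}" by (auto simp: components_def)
    then have "g \<in> ?gen ` ?S" using zero by blast
    with g(1) show "W \<in> (\<lambda>s. \<Gamma> (?gen s)) ` ?S" by auto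
  next
    fix W assume "W \<in> (\<lambda>s. \<Gamma> (?gen s)) ` ?S"
    then obtain s where s: "s \<in> ?S" "W = \<Gamma> (?gen s)" by blast
    moreover have "\<Gamma> (?gen s) \<noteq> {0}"
      using u[OF s(1)] span_base[of "u s" "{u s}"] by auto
    ultimately show "W \<in> components ?U \<Gamma>" using gen_closed by (auto simp: components_def)
  qed
  show ?thesis by (rule that[OF basis span_single comps])
qed

section \<open>The Weyl group by the first isomorphism theorem\<close>

theorem mainTheorem15:
  fixes scale :: "'a::alg_closed_field \<Rightarrow> 'v::ab_group_add \<Rightarrow> 'v"
    and b :: "'v \<Rightarrow> 'v \<Rightarrow> 'a"
    and X :: "'v list \<Rightarrow> 'v"
    and n p q :: nat
    and \<Gamma> :: "(U_symbol \<Rightarrow>\<^sub>0 int) set \<Rightarrow> 'v set"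
  assumes "CHAR('a) \<noteq> 2"
    and "n \<ge> 3"
    and "vector_space scale"
    and "vector_space.dim scale (UNIV :: 'v set) = n"
    and "nondegenerate_symmetric_bilinear_form scale b"
    and "cross_product scale (n - 1) b X"
    and "p + 2 * q = n"
    and "is_Gamma scale (n - 1) b X (U_group p q) (delta_U p q) \<Gamma>"
  shows "\<exists>\<Psi> \<in> iso (Weyl_group scale (n - 1) X (U_group p q) \<Gamma>)
                  (sym_group p \<times>\<times> signed_permutation_group q).
    \<forall>\<phi> \<in> carrier (Aut_grading scale (n - 1) X (U_group p q) \<Gamma>).
    \<forall>\<sigma> \<epsilon> \<tau>.
      \<Psi> (Stab_grading scale (n - 1) X (U_group p q) \<Gamma>
           #>\<^bsub>Aut_grading scale (n - 1) X (U_group p q) \<Gamma>\<^esub> \<phi>) = (\<sigma>, \<epsilon>, \<tau>) \<longrightarrow>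
      (\<forall>i\<in>{1..p}. \<phi> ` \<Gamma> (U_gen p q (XS i)) = \<Gamma> (U_gen p q (XS (\<sigma> i)))) \<and>
      (\<forall>j\<in>{1..q}.
        if \<epsilon> (\<tau> j) = 0
        then \<phi> ` \<Gamma> (U_gen p q (YS j)) = \<Gamma> (U_gen p q (YS (\<tau> j))) \<and>
             \<phi> ` \<Gamma> (U_gen p q (ZS j)) = \<Gamma> (U_gen p q (ZS (\<tau> j)))
        else \<phi> ` \<Gamma> (U_gen p q (YS j)) = \<Gamma> (U_gen p q (ZS (\<tau> j))) \<and>
             \<phi> ` \<Gamma> (U_gen p q (ZS j)) = \<Gamma> (U_gen p q (YS (\<tau> j))))"
proof -
  let ?S = "U_symbols p q" and ?T = "symbol_group p q"
  define L where "L s = \<Gamma> (U_gen p q s)" for s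
  define A where "A = Aut_grading scale (n - 1) X (U_group p q) \<Gamma>"
  define St where "St = Stab_grading scale (n - 1) X (U_group p q) \<Gamma>"
  obtain e where basis: "cross_product_basis scale b X (n - 1) ?S e partner"
    and L_span: "\<And>s. s \<in> ?S \<Longrightarrow> L s = module.span scale {e s}"
    and comps: "components (U_group p q) \<Gamma> = L ` ?S"
    unfolding L_def using exists_homogeneous_basis[OF assms] by metis
  interpret cross_product_basis scale b X "n - 1" ?S e partner by (rule basis)
  interpret A: group A unfolding A_def by (rule group_Aut_grading[OF assms(3)])
  have A_mult: "x \<otimes>\<^bsub>A\<^esub> y = x \<circ> y" and A_one: "\<one>\<^bsub>A\<^esub> = id" for x y by (simp_all add: A_def)
  have A_carrier: "\<phi> \<in> carrier A \<longleftrightarrow> \<phi> \<in> carrier (Aut scale (n - 1) X) \<and> bij_betw ((`) \<phi>) (L ` ?S) (L ` ?S)"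
    for \<phi> by (simp add: A_def Aut_grading_carrier comps)
  have St: "St = {\<phi> \<in> carrier A. \<forall>s\<in>?S. \<phi> ` L s = L s}"
    by (auto simp: St_def A_def Stab_grading_def comps)
  have L_inj: "inj_on L ?S"
  proof (rule inj_onI)
    fix s t assume st: "s \<in> ?S" "t \<in> ?S" "L s = L t"
    then have "e s \<in> span {e t}" using L_span span_base[of "e s" "{e s}"] by auto
    then obtain c where "e s = scale c (e t)" unfolding span_singleton by blast
    then have "b (e s) (e (partner s)) = c * b (e t) (e (partner s))" by (simp add: b_scale_left)
    with st(1,2) show "s = t" by (auto simp: b_e prt_eq_iff split: if_splits)
  qed
  have image_L: "\<phi> ` L s = span {\<phi> (e s)}"
    if "Vector_Spaces.linear scale scale \<phi>" "s \<in> ?S" for \<phi> s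
  proof -
    interpret l: Vector_Spaces.linear scale scale \<phi> by fact
    show ?thesis using l.span_image[of "{e s}"] that(2) by (simp add: L_span)
  qed
  have ex: "\<exists>x\<in>carrier ?T. \<forall>s\<in>?S. \<phi> ` L s = L (symbol_perm x s)" if \<phi>: "\<phi> \<in> carrier A" for \<phi>
  proof -
    have aut: "\<phi> \<in> carrier (Aut scale (n - 1) X)" and bij: "bij_betw ((`) \<phi>) (L ` ?S) (L ` ?S)"
      using \<phi> A_carrier by auto
    have lin: "Vector_Spaces.linear scale scale \<phi>" using aut by (simp add: Aut_carrier)
    \<comment> \<open>Distinct symbols have distinct components, so the permutation of components
      transports along \<open>L\<close> to one of symbols.\<close>
    define \<pi> where "\<pi> = inv_into ?S L \<circ> (`) \<phi> \<circ> L"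
    have L_bij: "bij_betw L ?S (L ` ?S)" using L_inj by (simp add: bij_betw_def)
    have \<pi>: "bij_betw \<pi> ?S ?S"
      unfolding \<pi>_def by (intro bij_betw_trans[OF L_bij] bij_betw_trans[OF bij] bij_betw_inv_into[OF L_bij])
    have L_\<pi>: "\<phi> ` L s = L (\<pi> s)" if "s \<in> ?S" for s
    proof -
      have "\<phi> ` L s \<in> L ` ?S" using bij_betw_apply[OF bij] that by blast
      then show ?thesis by (simp add: \<pi>_def f_inv_into_f)
    qed
    have "\<exists>a. \<phi> (e s) = scale a (e (\<pi> s))" if s: "s \<in> ?S" for s
    proof -
      have "\<phi> (e s) \<in> L (\<pi> s)"
        using L_\<pi>[OF s] image_L[OF lin s] span_base[of "\<phi> (e s)" "{\<phi> (e s)}"] by auto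
      then show ?thesis using L_span[of "\<pi> s"] \<pi> s by (auto simp: bij_betw_def span_singleton)
    qed
    then obtain a where "\<And>s. s \<in> ?S \<Longrightarrow> \<phi> (e s) = scale (a s) (e (\<pi> s))" by metis
    from Aut_permutation_commutes_prt[OF aut \<pi> this]
    obtain x where "x \<in> carrier ?T" "\<forall>s\<in>?S. \<pi> s = symbol_perm x s"
      using symbol_perm_surj[OF \<pi>] by metis
    with L_\<pi> show ?thesis by auto
  qed
  have uniq: "x = y"
    if "x \<in> carrier ?T" "y \<in> carrier ?T" "\<And>s. s \<in> ?S \<Longrightarrow> L (symbol_perm x s) = L (symbol_perm y s)" for x y
  proof (rule symbol_perm_inj[OF that(1,2)])
    fix s assume "s \<in> ?S"
    with that show "symbol_perm x s = symbol_perm y s"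
      using L_inj symbol_perm_in by (meson inj_onD)
  qed
  \<comment> \<open>The choice is forced: \<open>uniq\<close> shows that the action on components
    determines the group element.\<close>
  define \<theta> where "\<theta> \<phi> = (SOME x. x \<in> carrier ?T \<and> (\<forall>s\<in>?S. \<phi> ` L s = L (symbol_perm x s)))" for \<phi>
  have \<theta>: "\<theta> \<phi> \<in> carrier ?T" "\<And>s. s \<in> ?S \<Longrightarrow> \<phi> ` L s = L (symbol_perm (\<theta> \<phi>) s)"
    if "\<phi> \<in> carrier A" for \<phi>
    using someI_ex[of "\<lambda>x. x \<in> carrier ?T \<and> (\<forall>s\<in>?S. \<phi> ` L s = L (symbol_perm x s))"] ex[OF that]
    unfolding \<theta>_def by blast+
  have \<theta>_eq: "\<theta> \<phi> = x"
    if "\<phi> \<in> carrier A" "x \<in> carrier ?T" "\<And>s. s \<in> ?S \<Longrightarrow> \<phi> ` L s = L (symbol_perm x s)" for \<phi> x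
    using that \<theta>[OF that(1)] by (intro uniq) auto
  have hom: "\<theta> \<in> hom A ?T"
  proof (rule homI)
    fix \<phi> \<psi> assume \<phi>: "\<phi> \<in> carrier A" and \<psi>: "\<psi> \<in> carrier A"
    show "\<theta> (\<phi> \<otimes>\<^bsub>A\<^esub> \<psi>) = \<theta> \<phi> \<otimes>\<^bsub>?T\<^esub> \<theta> \<psi>"
    proof (rule \<theta>_eq)
      fix s assume s: "s \<in> ?S"
      have "(\<phi> \<otimes>\<^bsub>A\<^esub> \<psi>) ` L s = \<phi> ` L (symbol_perm (\<theta> \<psi>) s)"
        unfolding A_mult image_comp[symmetric] \<theta>(2)[OF \<psi> s] ..
      also have "\<dots> = L (symbol_perm (\<theta> \<phi>) (symbol_perm (\<theta> \<psi>) s))"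
        by (rule \<theta>(2)[OF \<phi> symbol_perm_in[OF \<theta>(1)[OF \<psi>] s]])
      finally show "(\<phi> \<otimes>\<^bsub>A\<^esub> \<psi>) ` L s = L (symbol_perm (\<theta> \<phi> \<otimes>\<^bsub>?T\<^esub> \<theta> \<psi>) s)"
        by (simp add: symbol_perm_mult[OF \<theta>(1)[OF \<phi>] \<theta>(1)[OF \<psi>] s])
    qed (use \<phi> \<psi> \<theta>(1) symbol_group_mult_closed in auto)
  qed (rule \<theta>(1))
  have onto: "\<theta> ` carrier A = carrier ?T"
  proof
    show "carrier ?T \<subseteq> \<theta> ` carrier A"
    proof
      fix x assume x: "x \<in> carrier ?T"
      \<comment> \<open>The exponent is \<open>n - 2\<close>, which is positive because
        \<open>n \<ge> 3\<close>; algebraic closure then supplies roots in every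
        characteristic.\<close>
      have "\<exists>y. y ^ (n - 1 - 1) = c" for c :: 'a using assms(2) by (intro nth_root_exists) simp
      then obtain \<phi> c where \<phi>: "\<phi> \<in> carrier (Aut scale (n - 1) X)" "c \<noteq> 0"
        and \<phi>_e: "\<And>s. s \<in> ?S \<Longrightarrow> \<phi> (e s) = scale c (e (symbol_perm x s))"
        using Aut_realizing_permutation[OF symbol_perm_bij[OF x] symbol_perm_partner] assms(2) by auto
      have img: "\<phi> ` L s = L (symbol_perm x s)" if s: "s \<in> ?S" for s
      proof -
        have lin: "Vector_Spaces.linear scale scale \<phi>" using \<phi>(1) by (simp add: Aut_carrier)
        have "scale (inverse c) (scale c (e (symbol_perm x s))) \<in> span {scale c (e (symbol_perm x s))}"
          by (intro span_scale span_base) simp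
        then have "span {scale c (e (symbol_perm x s))} = span {e (symbol_perm x s)}"
          using \<phi>(2) by (simp add: span_eq span_scale span_base)
        then show ?thesis using image_L[OF lin s] \<phi>_e[OF s] L_span symbol_perm_in[OF x s] by simp
      qed
      have "bij_betw ((`) \<phi>) (L ` ?S) (L ` ?S)"
        unfolding bij_betw_def
      proof
        show "inj_on ((`) \<phi>) (L ` ?S)"
          using \<phi>(1) by (auto simp: Aut_carrier bij_is_inj inj_image_eq_iff intro!: inj_onI)
        have "(`) \<phi> ` L ` ?S = L ` symbol_perm x ` ?S"
          unfolding image_image using img by (intro image_cong) auto
        then show "(`) \<phi> ` L ` ?S = L ` ?S" using symbol_perm_bij[OF x] by (simp add: bij_betw_def)
      qed
      with \<phi>(1) have "\<phi> \<in> carrier A" by (simp add: A_carrier)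
      with \<theta>_eq[OF this x img] show "x \<in> \<theta> ` carrier A" by blast
    qed
  qed (use \<theta>(1) in blast)
  have \<theta>_one: "\<theta> \<one>\<^bsub>A\<^esub> = \<one>\<^bsub>?T\<^esub>"
    by (rule \<theta>_eq[OF A.one_closed symbol_group_one_closed]) (simp add: A_one symbol_perm_one del: one_DirProd)
  \<comment> \<open>The group axioms of the target are inherited from \<open>A\<close>, of which it
    is the homomorphic image under \<theta>. \<open>T\<close> matches the record that
    \<open>hom_imp_img_group\<close> produces with the target itself.\<close>
  have T: "?T\<lparr>carrier := carrier ?T, one := \<one>\<^bsub>?T\<^esub>\<rparr> = ?T" by (simp add: DirProd_def)
  have "group ?T"
    using A.hom_imp_img_group[OF hom] unfolding onto \<theta>_one T .
  then interpret \<theta>: group_hom A ?T \<theta>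
    using hom A.group_axioms by (simp add: group_hom_def group_hom_axioms_def)
  have ker: "kernel A ?T \<theta> = St"
  proof -
    have "\<theta> \<phi> = \<one>\<^bsub>?T\<^esub> \<longleftrightarrow> (\<forall>s\<in>?S. \<phi> ` L s = L s)" if "\<phi> \<in> carrier A" for \<phi>
      using \<theta>(2)[OF that] \<theta>_eq[OF that symbol_group_one_closed] symbol_perm_one by metis
    then show ?thesis unfolding kernel_def St by blast
  qed
  have iso: "(\<lambda>C. the_elem (\<theta> ` C)) \<in> iso (Weyl_group scale (n - 1) X (U_group p q) \<Gamma>) ?T"
    using \<theta>.FactGroup_iso_set[OF onto] unfolding ker unfolding Weyl_group_def A_def St_def .
  \<comment> \<open>\<theta> is constant on cosets of its kernel, so the image of a coset is a
    singleton and \<open>the_elem\<close> returns the value at any representative.\<close>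
  have coset_value: "the_elem (\<theta> ` (St #>\<^bsub>A\<^esub> \<phi>)) = \<theta> \<phi>" if \<phi>: "\<phi> \<in> carrier A" for \<phi>
  proof -
    have eq: "\<theta> (k \<otimes>\<^bsub>A\<^esub> \<phi>) = \<theta> \<phi>" if "k \<in> St" for k
      using that \<phi> \<theta>.H.l_one[OF \<theta>.hom_closed[OF \<phi>]]
      unfolding ker[symmetric] kernel_def by (simp del: one_DirProd)
    have "\<theta> ` (St #>\<^bsub>A\<^esub> \<phi>) = (\<lambda>k. \<theta> (k \<otimes>\<^bsub>A\<^esub> \<phi>)) ` St" unfolding r_coset_def by auto
    also have "\<dots> = (\<lambda>k. \<theta> \<phi>) ` St" by (intro image_cong refl eq)
    also have "\<dots> = {\<theta> \<phi>}"
      using \<theta>.subgroup_kernel subgroup.one_closed unfolding ker by (metis empty_iff image_constant_conv)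
    finally have "\<theta> ` (St #>\<^bsub>A\<^esub> \<phi>) = {\<theta> \<phi>}" .
    then show ?thesis by simp
  qed
  show ?thesis
    unfolding A_def[symmetric] St_def[symmetric] L_def[symmetric]
  proof (intro bexI[OF _ iso] ballI allI impI)
    fix \<phi> \<sigma> \<epsilon> \<tau>
    assume \<phi>: "\<phi> \<in> carrier A" and "the_elem (\<theta> ` (St #>\<^bsub>A\<^esub> \<phi>)) = (\<sigma>, \<epsilon>, \<tau>)"
    then have "\<phi> ` L s = L (symbol_perm (\<sigma>, \<epsilon>, \<tau>) s)" if "s \<in> ?S" for s
      using \<theta>(2)[OF \<phi> that] coset_value[OF \<phi>] by simp
    from this[of "XS _"] this[of "YS _"] this[of "ZS _"]
    show "(\<forall>i\<in>{1..p}. \<phi> ` L (XS i) = L (XS (\<sigma> i))) \<and>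
      (\<forall>j\<in>{1..q}. if \<epsilon> (\<tau> j) = 0
        then \<phi> ` L (YS j) = L (YS (\<tau> j)) \<and> \<phi> ` L (ZS j) = L (ZS (\<tau> j))
        else \<phi> ` L (YS j) = L (ZS (\<tau> j)) \<and> \<phi> ` L (ZS j) = L (YS (\<tau> j)))"
      by simp
  qed
qed

end
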